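(* If the set $R$ of weights contains at least two distinct weights, then the equational satisfiability problem — given two formulas $\Phi_1,\Phi_2$, decide whether there exists a pair $(w,\sigma)$ with $[\![\Phi_1]\!](w,\sigma)=[\![\Phi_2]\!](w,\sigma)$ — is undecidable, both for core-wMSO formulas and for core-wFO formulas.
   Context: Finite alphabet $\Sigma$, weight set $R$. MSO: $\varphi::=\top\mid P_a(x)\mid x\le y\mid x\in X\mid\neg\varphi\mid\varphi\wedge\varphi\mid\forall x.\varphi\mid\forall X.\varphi$, interpreted over $(w,\sigma)$ with $w\in\Sigma^+$ and $\sigma$ mapping first-order variables to positions $\{1,\dots,|w|\}$ and second-order variables to sets of positions. step-wMSO: $\Psi::=r\mid\varphi\,?\,\Psi_1:\Psi_2$ ($r\in R$), $[\![r]\!]=r$, conditional selects $\Psi_1$ if $\varphi$ holds, else $\Psi_2$. core-wMSO: $\Phi::=\mathbf{0}\mid\prod_x\Psi\mid\varphi\,?\,\Phi_1:\Phi_2\mid\Phi_1+\Phi_2\mid\sum_x\Phi\mid\sum_X\Phi$, with values finite multisets of words over $R$: $[\![\mathbf{0}]\!]=\emptyset$; $[\![\prod_x\Psi]\!](w,\sigma)$ the multiset with single word $r_1\cdots r_{|w|}$, $r_i=[\![\Psi]\!](w,\sigma[x\mapsto i])$; conditional selects by $\varphi$; $+$ is multiset union; $[\![\sum_x\Phi]\!](w,\sigma)=\biguplus_{i=1}^{|w|}[\![\Phi]\!](w,\sigma[x\mapsto i])$; $[\![\sum_X\Phi]\!](w,\sigma)=\biguplus_{I\subseteq\{1,\dots,|w|\}}[\![\Phi]\!](w,\sigma[X\mapsto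 I])$. core-wFO is the fragment of core-wMSO in which all MSO conditions (including those inside step-wMSO formulas) are first-order formulas (no second-order variables) and the construct $\sum_X$ is not used. *)

theory Defs
  imports "HOL-Library.Multiset" "HOL-Library.Nat_Bijection"
begin

section \<open>Syntax\<close>

text \<open>First-order and second-order variables are two separate sorts, each indexed by
  \<^typ>\<open>nat\<close>. The type \<open>'a\<close> is the alphabet.\<close>

datatype 'a mso =
    MTrue
  | MLetter 'a nat
  | MLe nat nat
  | MIn nat nat
  | MNeg "'a mso"
  | MConj "'a mso" "'a mso"
  | MAll1 nat "'a mso"
  | MAll2 nat "'a mso"

datatype ('a, step_weights: 'r) step =
    SConst 'r
  | SIf "'a mso" "('a, 'r) step" "('a, 'r) step"

datatype ('a, core_weights: 'r) core =
    CZero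
  | CProd nat "('a, 'r) step"
  | CIf "'a mso" "('a, 'r) core" "('a, 'r) core"
  | CPlus "('a, 'r) core" "('a, 'r) core"
  | CSum1 nat "('a, 'r) core"
  | CSum2 nat "('a, 'r) core"

primrec fo_mso :: "'a mso \<Rightarrow> bool" where
  "fo_mso MTrue \<longleftrightarrow> True"
| "fo_mso (MLetter a x) \<longleftrightarrow> True"
| "fo_mso (MLe x y) \<longleftrightarrow> True"
| "fo_mso (MIn x X) \<longleftrightarrow> False"
| "fo_mso (MNeg \<phi>) \<longleftrightarrow> fo_mso \<phi>"
| "fo_mso (MConj \<phi> \<psi>) \<longleftrightarrow> fo_mso \<phi> \<and> fo_mso \<psi>"
| "fo_mso (MAll1 x \<phi>) \<longleftrightarrow> fo_mso \<phi>"
| "fo_mso (MAll2 X \<phi>) \<longleftrightarrow> False"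

primrec fo_step :: "('a, 'r) step \<Rightarrow> bool" where
  "fo_step (SConst r) \<longleftrightarrow> True"
| "fo_step (SIf \<phi> \<Psi>1 \<Psi>2) \<longleftrightarrow> fo_mso \<phi> \<and> fo_step \<Psi>1 \<and> fo_step \<Psi>2"

primrec fo_core :: "('a, 'r) core \<Rightarrow> bool" where
  "fo_core CZero \<longleftrightarrow> True"
| "fo_core (CProd x \<Psi>) \<longleftrightarrow> fo_step \<Psi>"
| "fo_core (CIf \<phi> \<Phi>1 \<Phi>2) \<longleftrightarrow> fo_mso \<phi> \<and> fo_core \<Phi>1 \<and> fo_core \<Phi>2"
| "fo_core (CPlus \<Phi>1 \<Phi>2) \<longleftrightarrow> fo_core \<Phi>1 \<and> fo_core \<Phi>2"
| "fo_core (CSum1 x \<Phi>) \<longleftrightarrow> fo_core \<Phi>"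
| "fo_core (CSum2 X \<Phi>) \<longleftrightarrow> False"

definition core_wMSO :: "'r set \<Rightarrow> ('a, 'r) core set" where
  "core_wMSO R = {\<Phi>. core_weights \<Phi> \<subseteq> R}"

definition core_wFO :: "'r set \<Rightarrow> ('a, 'r) core set" where
  "core_wFO R = {\<Phi> \<in> core_wMSO R. fo_core \<Phi>}"

section \<open>Semantics\<close>

text \<open>A valuation is a pair of maps, one for each sort of variable. Positions are counted
  from 1, list indices from 0, hence the shift in the clause for letters.\<close>

definition positions :: "'a list \<Rightarrow> nat set" where
  "positions w = {1..length w}"

definition valuation :: "'a list \<Rightarrow> (nat \<Rightarrow> nat) \<Rightarrow> (nat \<Rightarrow> nat set) \<Rightarrow> bool" where
  "valuation w s S \<longleftrightarrow> (\<forall>x. s x \<in> positions w) \<and> (\<forall>X. S X \<subseteq> positions w)"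

primrec mso_sem :: "'a mso \<Rightarrow> 'a list \<Rightarrow> (nat \<Rightarrow> nat) \<Rightarrow> (nat \<Rightarrow> nat set) \<Rightarrow> bool" where
  "mso_sem MTrue w s S \<longleftrightarrow> True"
| "mso_sem (MLetter a x) w s S \<longleftrightarrow> w ! (s x - 1) = a"
| "mso_sem (MLe x y) w s S \<longleftrightarrow> s x \<le> s y"
| "mso_sem (MIn x X) w s S \<longleftrightarrow> s x \<in> S X"
| "mso_sem (MNeg \<phi>) w s S \<longleftrightarrow> \<not> mso_sem \<phi> w s S"
| "mso_sem (MConj \<phi> \<psi>) w s S \<longleftrightarrow> mso_sem \<phi> w s S \<and> mso_sem \<psi> w s S"
| "mso_sem (MAll1 x \<phi>) w s S \<longleftrightarrow> (\<forall>i\<in>positions w. mso_sem \<phi> w (s(x := i)) S)"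
| "mso_sem (MAll2 X \<phi>) w s S \<longleftrightarrow> (\<forall>I\<in>Pow (positions w). mso_sem \<phi> w s (S(X := I)))"

primrec step_sem :: "('a, 'r) step \<Rightarrow> 'a list \<Rightarrow> (nat \<Rightarrow> nat) \<Rightarrow> (nat \<Rightarrow> nat set) \<Rightarrow> 'r" where
  "step_sem (SConst r) w s S = r"
| "step_sem (SIf \<phi> \<Psi>1 \<Psi>2) w s S =
     (if mso_sem \<phi> w s S then step_sem \<Psi>1 w s S else step_sem \<Psi>2 w s S)"

primrec core_sem ::
  "('a, 'r) core \<Rightarrow> 'a list \<Rightarrow> (nat \<Rightarrow> nat) \<Rightarrow> (nat \<Rightarrow> nat set) \<Rightarrow> 'r list multiset" where
  "core_sem CZero w s S = {#}"
| "core_sem (CProd x \<Psi>) w s S = {# map (\<lambda>i. step_sem \<Psi> w (s(x := i)) S) [1..<Suc (length w)] #}"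
| "core_sem (CIf \<phi> \<Phi>1 \<Phi>2) w s S =
     (if mso_sem \<phi> w s S then core_sem \<Phi>1 w s S else core_sem \<Phi>2 w s S)"
| "core_sem (CPlus \<Phi>1 \<Phi>2) w s S = core_sem \<Phi>1 w s S + core_sem \<Phi>2 w s S"
| "core_sem (CSum1 x \<Phi>) w s S = (\<Sum>i\<in>positions w. core_sem \<Phi> w (s(x := i)) S)"
| "core_sem (CSum2 X \<Phi>) w s S = (\<Sum>I\<in>Pow (positions w). core_sem \<Phi> w s (S(X := I)))"

definition eq_sat :: "('a, 'r) core \<Rightarrow> ('a, 'r) core \<Rightarrow> bool" where
  "eq_sat \<Phi>1 \<Phi>2 \<longleftrightarrow>
     (\<exists>w s S. w \<noteq> [] \<and> valuation w s S \<and> core_sem \<Phi>1 w s S = core_sem \<Phi>2 w s S)"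

section \<open>Partial recursive functions\<close>

datatype recf =
    RZero
  | RSucc
  | RProj nat
  | RComp recf "recf list"
  | RPrim recf recf
  | RMu recf

text \<open>\<open>reval p xs y\<close>: the program \<open>p\<close> halts on the argument list \<open>xs\<close> with result \<open>y\<close>.
  In \<open>RPrim\<close> the recursion argument comes first; in \<open>RMu\<close> the sought argument comes first,
  and all smaller arguments must yield a defined nonzero value.\<close>

inductive reval :: "recf \<Rightarrow> nat list \<Rightarrow> nat \<Rightarrow> bool" where
  zero: "reval RZero xs 0"
| succ: "reval RSucc [x] (Suc x)"
| proj: "i < length xs \<Longrightarrow> reval (RProj i) xs (xs ! i)"
| comp: "length ys = length gs \<Longrightarrow> (\<forall>i<length gs. reval (gs ! i) xs (ys ! i)) \<Longrightarrow>
    reval f ys z \<Longrightarrow> reval (RComp f gs) xs z"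
| prim_0: "reval f xs y \<Longrightarrow> reval (RPrim f g) (0 # xs) y"
| prim_Suc: "reval (RPrim f g) (n # xs) y \<Longrightarrow> reval g (n # y # xs) z \<Longrightarrow>
    reval (RPrim f g) (Suc n # xs) z"
| mu: "reval f (n # xs) 0 \<Longrightarrow> (\<forall>m<n. \<exists>y. 0 < y \<and> reval f (m # xs) y) \<Longrightarrow> reval (RMu f) xs n"

inductive_cases reval_RZeroE: "reval RZero xs y"
inductive_cases reval_RSuccE: "reval RSucc xs y"
inductive_cases reval_RProjE: "reval (RProj i) xs y"
inductive_cases reval_RCompE: "reval (RComp f gs) xs y"
inductive_cases reval_RPrim0E: "reval (RPrim f g) (0 # xs) y"
inductive_cases reval_RPrimSucE: "reval (RPrim f g) (Suc n # xs) y"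
inductive_cases reval_RMuE: "reval (RMu f) xs y"

lemma reval_deterministic: "reval p xs y \<Longrightarrow> reval p xs z \<Longrightarrow> y = z"
proof (induction arbitrary: z rule: reval.induct)
  case (comp ys gs xs f z')
  from comp.prems obtain ys' where ys': "length ys' = length gs"
    "\<forall>i<length gs. reval (gs ! i) xs (ys' ! i)" "reval f ys' z"
    by (rule reval_RCompE)
  have "ys = ys'"
    using comp.hyps comp.IH ys' by (intro nth_equalityI) auto
  with comp.IH ys' show ?case by blast
next
  case (prim_Suc f g n xs y z')
  from prim_Suc.prems obtain y' where "reval (RPrim f g) (n # xs) y'" "reval g (n # y' # xs) z"
    by (rule reval_RPrimSucE)
  with prim_Suc.IH show ?case by blast
next
  case (mu f n xs)
  from mu.prems have z: "reval f (z # xs) 0" "\<forall>m<z. \<exists>y. 0 < y \<and> reval f (m # xs) y"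
    by (rule reval_RMuE, blast)+
  have "\<not> n < z"
  proof
    assume "n < z"
    then obtain y where "0 < y" "reval f (n # xs) y" using z(2) by blast
    then show False using mu.IH(1) by blast
  qed
  moreover have "\<not> z < n"
  proof
    assume "z < n"
    then obtain y where y: "0 < y" "\<forall>u. reval f (z # xs) u \<longrightarrow> y = u" using mu.IH(2) by blast
    from y(2) z(1) have "y = 0" by blast
    with y(1) show False by simp
  qed
  ultimately show ?case by simp
qed (blast elim: reval_RZeroE reval_RSuccE reval_RProjE reval_RPrim0E)+

text \<open>The decision problem with instance set \<open>I\<close> and question \<open>Q\<close>, under the numbering \<open>c\<close>
  of the instances. The program may behave arbitrarily on numbers that are not codes of instances,
  since the set of these codes need not be recursive.\<close>

definition decidable_problem :: "'i set \<Rightarrow> ('i \<Rightarrow> nat) \<Rightarrow> ('i \<Rightarrow> bool) \<Rightarrow> bool" where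
  "decidable_problem I c Q \<longleftrightarrow> (\<exists>p. \<forall>x\<in>I. reval p [c x] (if Q x then 1 else 0))"

section \<open>Numbering of formulas\<close>

text \<open>Structural numberings by Cantor pairing, relative to numberings \<open>lc\<close> of the letters
  and \<open>rc\<close> of the weights.\<close>

primrec mso_code :: "('a \<Rightarrow> nat) \<Rightarrow> 'a mso \<Rightarrow> nat" where
  "mso_code lc MTrue = prod_encode (0, 0)"
| "mso_code lc (MLetter a x) = prod_encode (1, prod_encode (lc a, x))"
| "mso_code lc (MLe x y) = prod_encode (2, prod_encode (x, y))"
| "mso_code lc (MIn x X) = prod_encode (3, prod_encode (x, X))"
| "mso_code lc (MNeg \<phi>) = prod_encode (4, mso_code lc \<phi>)"
| "mso_code lc (MConj \<phi> \<psi>) = prod_encode (5, prod_encode (mso_code lc \<phi>, mso_code lc \<psi>))"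
| "mso_code lc (MAll1 x \<phi>) = prod_encode (6, prod_encode (x, mso_code lc \<phi>))"
| "mso_code lc (MAll2 X \<phi>) = prod_encode (7, prod_encode (X, mso_code lc \<phi>))"

primrec step_code :: "('a \<Rightarrow> nat) \<Rightarrow> ('r \<Rightarrow> nat) \<Rightarrow> ('a, 'r) step \<Rightarrow> nat" where
  "step_code lc rc (SConst r) = prod_encode (0, rc r)"
| "step_code lc rc (SIf \<phi> \<Psi>1 \<Psi>2) = prod_encode (1, prod_encode (mso_code lc \<phi>,
     prod_encode (step_code lc rc \<Psi>1, step_code lc rc \<Psi>2)))"

primrec core_code :: "('a \<Rightarrow> nat) \<Rightarrow> ('r \<Rightarrow> nat) \<Rightarrow> ('a, 'r) core \<Rightarrow> nat" where
  "core_code lc rc CZero = prod_encode (0, 0)"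
| "core_code lc rc (CProd x \<Psi>) = prod_encode (1, prod_encode (x, step_code lc rc \<Psi>))"
| "core_code lc rc (CIf \<phi> \<Phi>1 \<Phi>2) = prod_encode (2, prod_encode (mso_code lc \<phi>,
     prod_encode (core_code lc rc \<Phi>1, core_code lc rc \<Phi>2)))"
| "core_code lc rc (CPlus \<Phi>1 \<Phi>2) =
     prod_encode (3, prod_encode (core_code lc rc \<Phi>1, core_code lc rc \<Phi>2))"
| "core_code lc rc (CSum1 x \<Phi>) = prod_encode (4, prod_encode (x, core_code lc rc \<Phi>))"
| "core_code lc rc (CSum2 X \<Phi>) = prod_encode (5, prod_encode (X, core_code lc rc \<Phi>))"

definition pair_code ::
  "('a \<Rightarrow> nat) \<Rightarrow> ('r \<Rightarrow> nat) \<Rightarrow> ('a, 'r) core \<times> ('a, 'r) core \<Rightarrow> nat" where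
  "pair_code lc rc = (\<lambda>(\<Phi>1, \<Phi>2). prod_encode (core_code lc rc \<Phi>1, core_code lc rc \<Phi>2))"

lemma mso_code_inj:
  assumes "inj lc"
  shows "mso_code lc \<phi> = mso_code lc \<psi> \<Longrightarrow> \<phi> = \<psi>"
proof (induction \<phi> arbitrary: \<psi>)
  case MTrue then show ?case by (cases \<psi>) simp_all
next
  case MLetter then show ?case using injD[OF assms] by (cases \<psi>) auto
next
  case MLe then show ?case by (cases \<psi>) simp_all
next
  case MIn then show ?case by (cases \<psi>) simp_all
next
  case MNeg then show ?case by (cases \<psi>) simp_all
next
  case MConj then show ?case by (cases \<psi>) simp_all
next
  case MAll1 then show ?case by (cases \<psi>) simp_all
next
  case MAll2 then show ?case by (cases \<psi>) simp_all
qed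

lemma step_code_inj:
  assumes "inj lc" and "inj_on rc R"
  shows "step_weights \<Psi> \<subseteq> R \<Longrightarrow> step_weights \<Psi>' \<subseteq> R \<Longrightarrow>
    step_code lc rc \<Psi> = step_code lc rc \<Psi>' \<Longrightarrow> \<Psi> = \<Psi>'"
proof (induction \<Psi> arbitrary: \<Psi>')
  case SConst then show ?case using inj_onD[OF assms(2)] by (cases \<Psi>') auto
next
  case SIf then show ?case using mso_code_inj[OF assms(1)] by (cases \<Psi>') simp_all
qed

lemma core_code_inj:
  assumes "inj lc" and "inj_on rc R"
  shows "core_weights \<Phi> \<subseteq> R \<Longrightarrow> core_weights \<Phi>' \<subseteq> R \<Longrightarrow>
    core_code lc rc \<Phi> = core_code lc rc \<Phi>' \<Longrightarrow> \<Phi> = \<Phi>'"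
proof (induction \<Phi> arbitrary: \<Phi>')
  case CZero then show ?case by (cases \<Phi>') simp_all
next
  case CProd then show ?case using step_code_inj[OF assms] by (cases \<Phi>') simp_all
next
  case CIf then show ?case using mso_code_inj[OF assms(1)] by (cases \<Phi>') simp_all
next
  case CPlus then show ?case by (cases \<Phi>') simp_all
next
  case CSum1 then show ?case by (cases \<Phi>') simp_all
next
  case CSum2 then show ?case by (cases \<Phi>') simp_all
qed

lemma inj_on_pair_code:
  assumes "inj lc" and "inj_on rc R"
  shows "inj_on (pair_code lc rc) (core_wMSO R \<times> core_wMSO R)"
  using core_code_inj[OF assms]
  by (auto simp: inj_on_def pair_code_def core_wMSO_def)

end

theory Submission
  imports Defs "HOL-Number_Theory.Cong"
begin

text \<open>Over a one-letter alphabet a first-order formula sees nothing but the order, so the only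
  data left are the values of the free variables, and the problem amounts to Hilbert's tenth
  problem. Conversely, a polynomial with natural coefficients is the multiplicity of a constant word:
  a variable \<open>x\<close> contributes the number of positions below \<open>x\<close>, addition is \<open>+\<close>, and
  multiplication is nesting of sums. Hence solvability of a polynomial equation is an instance of
  equational satisfiability, and a second weight encodes one further equation side by side, which
  pins the parameter of the first to a given number.

  It remains to see that every partial recursive function has a Diophantine graph. By induction on
  the program this needs only closure of Diophantine predicates under bounded universal
  quantification: with it, primitive recursion and minimisation are expressed by sequences coded
  through the Chinese remainder theorem. Bounded quantification reduces to binomial coefficients and
  factorials, these to powers, and powers to the Pell equation \<open>x\<^sup>2 - (a\<^sup>2 - 1) y\<^sup>2 = 1\<close>.
  A decider of equational satisfiability would have a Diophantine graph, and diagonalising over the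
  codes of formulas yields an equation that is solvable iff the decider rejects it.\<close>

section \<open>Solutions of the Pell equation\<close>

fun px :: "int \<Rightarrow> nat \<Rightarrow> int" and py :: "int \<Rightarrow> nat \<Rightarrow> int" where
  "px a 0 = 1"
| "px a (Suc n) = a * px a n + (a * a - 1) * py a n"
| "py a 0 = 0"
| "py a (Suc n) = px a n + a * py a n"

lemma pell_eq: "px a n * px a n = 1 + (a * a - 1) * (py a n * py a n)"
proof (induction n)
  case (Suc n) then show ?case unfolding px.simps py.simps by algebra
qed simp

lemma pell_add:
  "px a (m + n) = px a m * px a n + (a * a - 1) * py a m * py a n \<and>
   py a (m + n) = px a m * py a n + py a m * px a n"
proof (induction m)
  case (Suc m)
  then show ?case unfolding add_Suc px.simps py.simps by algebra
qed simp

lemmas px_add = pell_add[THEN conjunct1]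
lemmas py_add = pell_add[THEN conjunct2]

lemma py_diff: "py a j = py a (j + n) * px a n - px a (j + n) * py a n"
  using pell_eq[of a n] unfolding px_add py_add by algebra

lemma pell_pos:
  assumes a: "1 \<le> a"
  shows "1 \<le> px a n \<and> 0 \<le> py a n"
proof (induction n)
  case (Suc n)
  have aa: "1 \<le> a * a" using mult_mono[of 1 a 1 a] a by simp
  have "1 \<le> a * px a n" using mult_mono[of 1 a 1 "px a n"] a Suc by simp
  moreover have "0 \<le> (a * a - 1) * py a n" "0 \<le> a * py a n" using Suc a aa by simp_all
  ultimately show ?case using Suc by simp
qed simp

lemmas px_pos = pell_pos[THEN conjunct1]
lemmas py_nonneg = pell_pos[THEN conjunct2]

lemma px_Suc_ge: "1 \<le> a \<Longrightarrow> a * px a n \<le> px a (Suc n)"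
  using py_nonneg[of a n] mult_mono[of 1 a 1 a] by simp

lemma py_Suc_ge: "1 \<le> a \<Longrightarrow> a * py a n + 1 \<le> py a (Suc n)"
  using px_pos[of a n] by simp

lemma strict_mono_px: assumes "2 \<le> a" shows "strict_mono (px a)"
proof (rule strict_mono_Suc_iff[THEN iffD2], rule allI)
  fix n
  have "px a n < 2 * px a n" using px_pos[of a n] assms by simp
  also have "\<dots> \<le> a * px a n" using px_pos[of a n] assms by (intro mult_right_mono) auto
  also have "\<dots> \<le> px a (Suc n)" using px_Suc_ge[of a n] assms by simp
  finally show "px a n < px a (Suc n)" .
qed

lemma strict_mono_py: assumes "1 \<le> a" shows "strict_mono (py a)"
proof (rule strict_mono_Suc_iff[THEN iffD2], rule allI)
  fix n
  have "1 * py a n \<le> a * py a n" using py_nonneg[of a n] assms by (intro mult_right_mono) auto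
  then show "py a n < py a (Suc n)" using py_Suc_ge[OF assms, of n] by simp
qed

lemma py_ge: assumes "1 \<le> a" shows "int n \<le> py a n"
proof (induction n)
  case (Suc n)
  then show ?case using strict_monoD[OF strict_mono_py[OF assms], of n "Suc n"] by linarith
qed simp

lemma py_Suc_ge_power: assumes "1 \<le> a" shows "a ^ n \<le> py a (Suc n)"
proof (induction n)
  case (Suc n)
  have "a * a ^ n \<le> a * py a (Suc n)" using Suc assms by (intro mult_left_mono) auto
  then show ?case using py_Suc_ge[OF assms, of "Suc n"] by simp
qed simp

lemma pell_cong:
  "a - b dvd px a n - px b n \<and> a - b dvd py a n - py b n"
proof (induction n)
  case (Suc n)
  then obtain k l where kl: "px a n - px b n = (a - b) * k" "py a n - py b n = (a - b) * l"
    by (auto elim!: dvdE)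
  have "px a (Suc n) - px b (Suc n)
      = (a - b) * (a * k + px b n + (a * a - 1) * l + (a + b) * py b n)"
    using kl unfolding px.simps by algebra
  moreover have "py a (Suc n) - py b (Suc n) = (a - b) * (k + a * l + py b n)"
    using kl unfolding py.simps by algebra
  ultimately show ?case by (metis dvd_triv_left)
qed simp

lemma pell_1: "px 1 n = 1 \<and> py 1 n = int n"
  by (induction n) simp_all

lemma py_cong_index: "a - 1 dvd py a n - int n"
  using pell_cong[of a 1 n] pell_1[of n] by simp

lemma px_cong_power:
  "2 * a * k - k * k - 1 dvd px a n - (a - k) * py a n - k ^ n"
proof (induction n)
  case (Suc n)
  then obtain l where l: "px a n - (a - k) * py a n - k ^ n = (2 * a * k - k * k - 1) * l" ..
  obtain P where P: "k ^ n = P" by blast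
  have "px a (Suc n) - (a - k) * py a (Suc n) - k ^ Suc n
      = (2 * a * k - k * k - 1) * (k * l + py a n)"
    using l unfolding px.simps py.simps power_Suc P by algebra
  then show ?case by simp
qed simp

lemma pell_solution:
  assumes a: "2 \<le> a"
  shows "0 \<le> x \<Longrightarrow> x * x = 1 + (a * a - 1) * (y * y) \<Longrightarrow> y = int m \<Longrightarrow>
    \<exists>n. x = px a n \<and> y = py a n"
proof (induction m arbitrary: x y rule: less_induct)
  case (less m)
  show ?case
  proof (cases "m = 0")
    case True
    with less.prems have "x * x = 1" by simp
    with less.prems(1) have "x = 1" by (auto simp: zmult_eq_1_iff)
    with True less.prems show ?thesis by (intro exI[of _ 0]) simp
  next
    case False
    define x' y' where "x' = a * x - (a * a - 1) * y" and "y' = a * y - x"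
    have y: "1 \<le> y" using False less.prems by simp
    have yy: "1 \<le> y * y" using mult_mono[of 1 y 1 y] y by simp
    have xx: "x * x = 1 + (a * y) * (a * y) - y * y"
      using less.prems(2) by (simp add: algebra_simps)
    have "x \<le> a * y"
    proof (rule ccontr)
      assume "\<not> x \<le> a * y"
      then have lt: "a * y < x" by simp
      have "0 \<le> a * y" using a y by simp
      then have "(a * y) * (a * y) < x * x" using lt by (intro mult_strict_mono[OF lt lt]) linarith+
      with xx yy show False by simp
    qed
    then have y'0: "0 \<le> y'" by (simp add: y'_def)
    have "(a - 1) * y < x"
    proof (rule ccontr)
      assume "\<not> (a - 1) * y < x"
      then have "x * x \<le> ((a - 1) * y) * ((a - 1) * y)" using less.prems(1) by (intro mult_mono) auto
      also have "\<dots> = (a * y) * (a * y) - (2 * a - 1) * (y * y)" by (simp add: algebra_simps)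
      also have "\<dots> \<le> (a * y) * (a * y) - 1 * (y * y)"
        using a yy by (intro diff_left_mono mult_right_mono) auto
      finally show False using xx by simp
    qed
    then have y'y: "y' < y" by (simp add: y'_def algebra_simps)
    have aa: "4 \<le> a * a" using mult_mono[of 2 a 2 a] a by simp
    have x'0: "0 \<le> x'"
    proof (rule ccontr)
      assume "\<not> 0 \<le> x'"
      then have le: "a * x \<le> (a * a - 1) * y" by (simp add: x'_def)
      have "0 \<le> a * x" using a less.prems(1) by simp
      then have "(a * x) * (a * x) \<le> ((a * a - 1) * y) * ((a * a - 1) * y)"
        using le by (intro mult_mono[OF le le]) linarith+
      also have "\<dots> = (a * a - 1) * (x * x) - (a * a - 1)"
        using less.prems(2) by algebra
      finally have "x * x + (a * a - 1) \<le> 0" by (simp add: algebra_simps)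
      with aa show False using zero_le_square[of x] by linarith
    qed
    have "x' * x' = 1 + (a * a - 1) * (y' * y')"
      using less.prems(2) unfolding x'_def y'_def by algebra
    moreover have "nat y' < m" "y' = int (nat y')" using y'0 y'y less.prems(3) by auto
    ultimately obtain n where "x' = px a n" "y' = py a n"
      using less.IH x'0 by blast
    then have "px a (Suc n) = a * x' + (a * a - 1) * y'" "py a (Suc n) = x' + a * y'" by simp_all
    then have "px a (Suc n) = x" "py a (Suc n) = y"
      unfolding x'_def y'_def by (algebra, algebra)
    then show ?thesis by metis
  qed
qed

lemma coprime_pell: "coprime (px a n) (py a n)"
proof (rule coprimeI)
  fix c assume "c dvd px a n" "c dvd py a n"
  then have "c dvd px a n * px a n - (a * a - 1) * (py a n * py a n)" by (metis dvd_diff dvd_mult)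
  then show "is_unit c" by (simp add: pell_eq)
qed

lemma pell_mult_cong:
  "py a m dvd py a (m * k) \<and>
   [px a (m * k) = px a m ^ k] (mod (py a m)\<^sup>2) \<and>
   [py a (m * k) * px a m = int k * px a m ^ k * py a m] (mod (py a m)\<^sup>2)"
proof (induction k)
  case (Suc k)
  let ?X = "px a m" and ?Y = "py a m"
  obtain l where l: "py a (m * k) = ?Y * l" using Suc by (auto elim!: dvdE)
  obtain c where c: "px a (m * k) - ?X ^ k = ?Y\<^sup>2 * c"
    using Suc by (metis cong_iff_dvd_diff dvdE)
  obtain e where e: "py a (m * k) * ?X - int k * ?X ^ k * ?Y = ?Y\<^sup>2 * e"
    using Suc by (metis cong_iff_dvd_diff dvdE)
  obtain P where P: "?X ^ k = P" by blast
  have mS: "m * Suc k = m * k + m" by simp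
  have "py a (m * Suc k) = ?Y * (px a (m * k) + l * ?X)"
    unfolding mS py_add l by (simp add: algebra_simps)
  moreover have "px a (m * Suc k) - ?X ^ Suc k
      = (px a (m * k) - P) * ?X + (a * a - 1) * (?Y * l) * ?Y"
    unfolding mS px_add power_Suc P l by (simp add: algebra_simps)
  then have "px a (m * Suc k) - ?X ^ Suc k = ?Y\<^sup>2 * (c * ?X + (a * a - 1) * l)"
    unfolding c[unfolded P] by (simp add: algebra_simps power2_eq_square)
  moreover have "py a (m * Suc k) * ?X - int (Suc k) * ?X ^ Suc k * ?Y
      = (px a (m * k) - P) * ?Y * ?X + (py a (m * k) * ?X - int k * P * ?Y) * ?X"
    unfolding mS py_add power_Suc of_nat_Suc P by (simp add: algebra_simps)
  then have "py a (m * Suc k) * ?X - int (Suc k) * ?X ^ Suc k * ?Y = ?Y\<^sup>2 * (c * ?X * ?Y + ?X * e)"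
    unfolding c[unfolded P] e[unfolded P] by (simp add: algebra_simps)
  ultimately show ?case by (simp add: cong_iff_dvd_diff)
qed simp

lemma py_dvd_imp:
  assumes a: "1 \<le> a" and m: "0 < m" and dvd: "py a m dvd py a n"
  shows "m dvd n"
proof -
  let ?q = "n div m" and ?r = "n mod m"
  have "py a n = py a (m * ?q + ?r)" by simp
  also have "\<dots> = px a (m * ?q) * py a ?r + py a (m * ?q) * px a ?r" by (rule py_add)
  finally have "py a m dvd px a (m * ?q) * py a ?r"
    using dvd pell_mult_cong[of a m ?q] by (metis dvd_add_left_iff dvd_mult2)
  moreover have "coprime (py a m) (px a (m * ?q))"
    using coprime_pell[of a "m * ?q"] pell_mult_cong[of a m ?q]
    by (meson coprime_commute coprime_divisors dvd_refl)
  ultimately have "py a m dvd py a ?r" by (simp add: coprime_dvd_mult_right_iff)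
  moreover have "py a ?r < py a m" using strict_monoD[OF strict_mono_py[OF a]] m by simp
  ultimately have "py a ?r = 0"
    using py_nonneg[OF a] zdvd_not_zless by (metis order_le_less)
  then have "?r = 0" using py_ge[OF a, of ?r] by simp
  then show ?thesis by blast
qed

lemma py_square_dvd_iff:
  "(py a m)\<^sup>2 dvd py a (m * k) \<longleftrightarrow> (py a m = 0 \<or> py a m dvd int k)"
proof (cases "py a m = 0")
  case True
  then show ?thesis using pell_mult_cong[of a m k] by simp
next
  case False
  have co: "coprime ((py a m)\<^sup>2) (px a m)" "coprime (py a m) (px a m ^ k)"
    using coprime_pell[of a m] by (simp_all add: coprime_commute)
  have "(py a m)\<^sup>2 dvd py a (m * k) \<longleftrightarrow> (py a m)\<^sup>2 dvd py a (m * k) * px a m"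
    using co(1) by (simp add: coprime_dvd_mult_left_iff)
  also have "\<dots> \<longleftrightarrow> (py a m)\<^sup>2 dvd int k * px a m ^ k * py a m"
    using pell_mult_cong[of a m k] cong_dvd_iff by metis
  also have "\<dots> \<longleftrightarrow> py a m dvd int k * px a m ^ k"
    using False by (simp add: power2_eq_square)
  also have "\<dots> \<longleftrightarrow> py a m dvd int k"
    using co(2) by (simp add: coprime_dvd_mult_left_iff)
  finally show ?thesis using False by simp
qed

lemma px_dvd_shift: "px a n dvd px a (2 * n + j) + px a j"
proof -
  have "px a (2 * n + j) + px a j
      = px a n * (px a (n + j) + px a n * px a j + (a * a - 1) * py a n * py a j)"
    using pell_eq[of a n] px_add[of a n "n + j"] py_add[of a n j]
    by (simp add: mult_2 add.assoc, algebra)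
  then show ?thesis by simp
qed

lemma px_dvd_reflect:
  assumes "i + j = 2 * n" shows "px a n dvd px a i + px a j"
proof -
  have *: "px a n dvd px a i + px a j" if ij: "i + j = 2 * n" "j \<le> n" for i j
  proof -
    define k where "k = n - j"
    have i: "i = n + k" and n: "n = k + j" using ij by (auto simp: k_def)
    have "py a k = py a n * px a j - px a n * py a j"
      using py_diff[of a k j] n by simp
    then have "px a i + px a j = px a n * (px a k + px a n * px a j - (a * a - 1) * py a n * py a j)"
      using pell_eq[of a n] px_add[of a n k] unfolding i by algebra
    then show ?thesis by simp
  qed
  show ?thesis
  proof (cases "j \<le> n")
    case True then show ?thesis using * assms by blast
  next
    case False
    then have "px a n dvd px a j + px a i" using assms by (intro *) auto
    then show ?thesis by (simp add: add.commute)
  qed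
qed

lemma px_inj_mod:
  assumes a: "3 \<le> a" and ij: "i \<le> 2 * n" "j \<le> 2 * n" and dvd: "px a n dvd px a i - px a j"
  shows "i = j"
proof -
  have mono: "strict_mono (px a)" using a by (intro strict_mono_px) simp
  have pos: "0 < px a k" for k using px_pos[of a k] a by simp
  have half: "2 * px a k < px a n" if "k < n" for k
  proof -
    have "2 * px a k < a * px a k" using pos[of k] a by simp
    also have "\<dots> \<le> px a (Suc k)" using px_Suc_ge[of a k] a by simp
    also have "\<dots> \<le> px a n" using that mono by (simp add: strict_mono_less_eq del: px.simps)
    finally show ?thesis .
  qed
  have low: "i = j" if "i \<le> j" "j \<le> n" "px a n dvd px a i - px a j" for i j
  proof -
    have "px a i \<le> px a j" "px a j \<le> px a n" using that mono by (simp_all add: strict_mono_less_eq)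
    then have "px a j - px a i < px a n" "0 \<le> px a j - px a i" using pos[of i] by linarith+
    moreover have "px a n dvd px a j - px a i" using that(3) by (simp add: dvd_diff_commute)
    ultimately have "px a j - px a i = 0" using zdvd_not_zless by (metis order_le_less)
    then show ?thesis using mono by (simp add: strict_mono_eq)
  qed
  have low': "i = j" if "i \<le> n" "j \<le> n" "px a n dvd px a i - px a j" for i j
    using low[of i j] low[of j i] that by (metis dvd_diff_commute nle_le)
  have no_sum: False if "i \<le> n" "j < n" "px a n dvd px a i + px a j" for i j
  proof (cases "i = n")
    case True
    then have "px a n dvd px a j" using that(3) by simp
    moreover have "px a j < px a n" using mono that(2) by (simp add: strict_mono_less)
    ultimately show False using pos[of j] zdvd_not_zless by blast
  next
    case False
    then have "px a i + px a j < px a n" using half[of i] half[of j] that by simp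
    then show False using that(3) pos[of i] pos[of j] zdvd_not_zless by (metis add_pos_pos)
  qed
  have refl: "px a n dvd px a i + px a (2 * n - i)" "px a n dvd px a j + px a (2 * n - j)"
    using ij by (intro px_dvd_reflect; simp)+
  consider "i \<le> n" "j \<le> n" | "i \<le> n" "n < j" | "n < i" "j \<le> n" | "n < i" "n < j" by linarith
  then show ?thesis
  proof cases
    case 1 then show ?thesis using low' dvd by blast
  next
    case 2
    have "px a n dvd px a i + px a (2 * n - j)"
      using dvd_add[OF dvd refl(2)] by simp
    moreover have "2 * n - j < n" using 2 ij by linarith
    ultimately show ?thesis using no_sum 2 by blast
  next
    case 3
    have "px a n dvd px a j + px a (2 * n - i)"
      using dvd_diff[OF refl(1) dvd] by (simp add: add.commute)
    moreover have "2 * n - i < n" using 3 ij by linarith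
    ultimately show ?thesis using no_sum 3 by blast
  next
    case 4
    have "px a n dvd px a (2 * n - i) - px a (2 * n - j)"
      using dvd_diff[OF dvd_diff[OF refl] dvd] by (simp add: algebra_simps)
    then have "2 * n - i = 2 * n - j" using 4 by (intro low') auto
    then show ?thesis using ij by simp
  qed
qed

lemma px_period: "px a n dvd px a (4 * n * q + r) - px a r"
proof (induction q)
  case (Suc q)
  let ?s = "4 * n * q + r"
  have "px a n dvd (px a (2 * n + (2 * n + ?s)) + px a (2 * n + ?s)) - (px a (2 * n + ?s) + px a ?s)"
    by (intro dvd_diff px_dvd_shift)
  then have "px a n dvd px a (2 * n + (2 * n + ?s)) - px a ?s"
    by (simp add: algebra_simps)
  from dvd_add[OF this Suc] show ?case by (simp add: algebra_simps)
qed simp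

lemma px_cong_index:
  assumes a: "3 \<le> a" and n: "0 < n" and i: "i \<le> n" and dvd: "px a n dvd px a i - px a j"
  shows "4 * int n dvd int j - int i \<or> 4 * int n dvd int j + int i"
proof -
  define q r where "q = j div (4 * n)" and "r = j mod (4 * n)"
  have j: "j = 4 * n * q + r" and r: "r < 4 * n" using n by (simp_all add: q_def r_def)
  have dr: "px a n dvd px a i - px a r"
    using dvd_add[OF dvd px_period[of a n q r]] by (simp add: j)
  show ?thesis
  proof (cases "r \<le> 2 * n")
    case True
    then have "i = r" using px_inj_mod[OF a _ _ dr] i by simp
    then show ?thesis by (simp add: j)
  next
    case False
    define k where "k = 2 * n - (4 * n - r)"
    have k: "2 * n + k = r" "k + (4 * n - r) = 2 * n" using False r by (simp_all add: k_def)
    have "px a n dvd (px a (2 * n + k) + px a k) - (px a k + px a (4 * n - r))"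
      using k(2) by (intro dvd_diff px_dvd_shift px_dvd_reflect)
    then have "px a n dvd px a r - px a (4 * n - r)" unfolding k(1) by simp
    from dvd_add[OF dr this] have "px a n dvd px a i - px a (4 * n - r)" by simp
    from px_inj_mod[OF a _ _ this] have "i = 4 * n - r" using i False by simp
    then have "int j + int i = 4 * int n * (int q + 1)" using r by (simp add: j algebra_simps)
    then show ?thesis by simp
  qed
qed

section \<open>Diophantine descriptions of powers, binomial coefficients and factorials\<close>

definition pell :: "nat \<Rightarrow> nat \<Rightarrow> nat \<Rightarrow> nat \<Rightarrow> bool" where
  "pell a k x y \<longleftrightarrow> int x = px (int a) k \<and> int y = py (int a) k"

definition pell_conic :: "nat \<Rightarrow> nat \<Rightarrow> nat \<Rightarrow> bool" where
  "pell_conic a x y \<longleftrightarrow> x * x + y * y = 1 + a * a * (y * y)"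

lemma pell_exists: "1 \<le> a \<Longrightarrow> \<exists>x y. pell a k x y"
  using px_pos[of "int a" k] py_nonneg[of "int a" k]
  by (intro exI[of _ "nat (px (int a) k)"] exI[of _ "nat (py (int a) k)"]) (simp add: pell_def)

lemma pell_conic_iff:
  assumes "2 \<le> a"
  shows "pell_conic a x y \<longleftrightarrow> (\<exists>n. pell a n x y)"
proof
  assume "pell_conic a x y"
  then have "int (x * x + y * y) = int (1 + a * a * (y * y))" by (simp add: pell_conic_def)
  then have "int x * int x = 1 + (int a * int a - 1) * (int y * int y)"
    by (simp add: algebra_simps)
  then show "\<exists>n. pell a n x y"
    using pell_solution[of "int a" "int x" "int y" y] assms by (auto simp: pell_def)
next
  assume "\<exists>n. pell a n x y"
  then obtain n where "pell a n x y" ..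
  then have "int (x * x + y * y) = int (1 + a * a * (y * y))"
    using pell_eq[of "int a" n] by (simp add: pell_def algebra_simps)
  then show "pell_conic a x y" unfolding pell_conic_def by (rule of_nat_eq_iff[THEN iffD1])
qed

text \<open>The index \<open>k\<close> of a solution is recovered from a solution \<open>(s, t)\<close> for a second base
  \<open>b\<close>: it has the same index modulo \<open>4 y\<close> since \<open>b \<equiv> 1\<close>, while \<open>b \<equiv> a\<close> modulo \<open>u\<close> and
  \<open>y\<^sup>2 dvd v\<close> determine it modulo \<open>4 y\<close> up to sign from the first components.\<close>

theorem matiyasevich_pell:
  assumes a: "3 \<le> a" and k: "1 \<le> k"
  shows "pell a k x y \<longleftrightarrow> pell_conic a x y \<and> k \<le> y \<and>
    (\<exists>u v s t b. pell_conic a u v \<and> pell_conic b s t \<and> 0 < v \<and> y * y dvd v \<and> 2 \<le> b \<and>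
      [b = 1] (mod 4 * y) \<and> [b = a] (mod u) \<and> [s = x] (mod u) \<and> [t = k] (mod 4 * y))"
    (is "_ \<longleftrightarrow> ?R")
proof
  assume xy: "pell a k x y"
  have "int k \<le> int y" using xy py_ge[of "int a" k] a by (simp add: pell_def)
  then have ky: "k \<le> y" by simp
  define m where "m = k * (2 * y)"
  obtain u v where uv: "pell a m u v" using pell_exists a by (metis One_nat_def Suc_leD numeral_3_eq_3)
  have "(py (int a) k)\<^sup>2 dvd py (int a) m"
    unfolding m_def py_square_dvd_iff using xy by (simp add: pell_def)
  then have "int (y * y) dvd int v" using xy uv by (simp add: pell_def power2_eq_square)
  then have yv: "y * y dvd v" by (simp only: of_nat_dvd_iff)
  have "m = k * y + k * y" by (simp add: m_def)
  then have "2 dvd int v" using uv py_add[of "int a" "k * y" "k * y"] by (simp add: pell_def)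
  then have "2 dvd v" by simp
  have "y dvd v" using yv by (rule dvd_mult_left)
  have uv': "coprime u v" using uv coprime_pell[of "int a" m]
    by (simp add: pell_def flip: coprime_int_iff)
  have "coprime u 2" "coprime u y"
    using coprime_divisors[OF dvd_refl \<open>2 dvd v\<close> uv'] coprime_divisors[OF dvd_refl \<open>y dvd v\<close> uv'] .
  then have "coprime (4 * y) u" using coprime_power_right_iff[of u 2 2]
    by (simp add: coprime_commute)
  then obtain b0 where b0: "[b0 = 1] (mod 4 * y)" "[b0 = a] (mod u)"
    using binary_chinese_remainder_nat by blast
  define b where "b = b0 + 2 * (4 * y * u)"
  have "b = b0 + (2 * u) * (4 * y)" "b = b0 + (8 * y) * u" by (simp_all add: b_def)
  then have b: "[b = 1] (mod 4 * y)" "[b = a] (mod u)"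
    using b0 unfolding cong_def by (metis mod_mult_self1)+
  have u: "0 < u" using uv px_pos[of "int a" m] a by (simp add: pell_def)
  have y: "0 < y" using ky k by simp
  have "0 < 4 * y * u" using u y by simp
  then have b2: "2 \<le> b" unfolding b_def by linarith
  have "int m \<le> int v" using uv py_ge[of "int a" m] a by (simp add: pell_def)
  moreover have "0 < m" using k y by (simp add: m_def)
  ultimately have v: "0 < v" by linarith
  obtain s t where st: "pell b k s t" using pell_exists b2 by (metis One_nat_def Suc_leD numeral_2_eq_2)
  have "int u dvd int b - int a" using b(2) by (simp add: cong_int_iff[symmetric] cong_iff_dvd_diff)
  from dvd_trans[OF this pell_cong[THEN conjunct1]] have "int u dvd int s - int x"
    using st xy by (simp add: pell_def)
  then have sx: "[s = x] (mod u)" by (simp add: cong_int_iff[symmetric] cong_iff_dvd_diff)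
  have "int (4 * y) dvd int b - int 1" using b(1) by (simp only: cong_int_iff[symmetric] cong_iff_dvd_diff)
  then have "int (4 * y) dvd int b - 1" by simp
  from dvd_trans[OF this py_cong_index] have "int (4 * y) dvd int t - int k"
    using st by (simp add: pell_def)
  then have tk: "[t = k] (mod 4 * y)" by (simp only: cong_int_iff[symmetric] cong_iff_dvd_diff)
  have "pell_conic a x y" "pell_conic a u v" "pell_conic b s t"
    using xy uv st pell_conic_iff[of a] pell_conic_iff[OF b2] a by auto
  with ky v yv b2 b sx tk show ?R by blast
next
  assume ?R
  then obtain u v s t b where c: "pell_conic a x y" "pell_conic a u v" "pell_conic b s t"
    and ky: "k \<le> y" and v: "0 < v" and yv: "y * y dvd v" and b2: "2 \<le> b"
    and b: "[b = 1] (mod 4 * y)" "[b = a] (mod u)"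
    and sx: "[s = x] (mod u)" and tk: "[t = k] (mod 4 * y)" by blast
  obtain i where i: "pell a i x y" using c(1) pell_conic_iff[of a] a by auto
  obtain n where n: "pell a n u v" using c(2) pell_conic_iff[of a] a by auto
  obtain j where j: "pell b j s t" using c(3) pell_conic_iff[of b] b2 by auto
  have y: "0 < y" using ky k by simp
  have "y \<le> v" using yv v y by (meson dvd_imp_le dvd_mult_left)
  then have "py (int a) i \<le> py (int a) n" using i n by (simp add: pell_def)
  then have "i \<le> n" using strict_mono_py[of "int a"] a by (simp add: strict_mono_less_eq)
  have n0: "0 < n" using n v by (cases n) (simp_all add: pell_def)
  have i0: "0 < i" using i y by (cases i) (simp_all add: pell_def)
  have "int u dvd int b - int a" using b(2) by (simp add: cong_int_iff[symmetric] cong_iff_dvd_diff)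
  from dvd_trans[OF this pell_cong[THEN conjunct1]] have "int u dvd px (int b) j - px (int a) j" .
  moreover have "int u dvd int s - int x" using sx by (simp add: cong_int_iff[symmetric] cong_iff_dvd_diff)
  ultimately have "int u dvd px (int a) i - px (int a) j"
    using i j dvd_diff[of "int u" "int s - int x" "px (int b) j - px (int a) j"]
    by (simp add: pell_def dvd_diff_commute)
  then have "px (int a) n dvd px (int a) i - px (int a) j" using n by (simp add: pell_def)
  then have ji: "4 * int n dvd int j - int i \<or> 4 * int n dvd int j + int i"
    using px_cong_index[of "int a"] a n0 \<open>i \<le> n\<close> by simp
  have "int y dvd int v" using yv by (auto intro: dvd_mult_left)
  then have "py (int a) i dvd py (int a) n" using i n by (simp only: pell_def)
  then have "i dvd n" using py_dvd_imp[of "int a" i n] i0 a by simp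
  then obtain q where q: "n = i * q" ..
  have "int (y * y) dvd int v" using yv by (simp only: of_nat_dvd_iff)
  then have "(py (int a) i)\<^sup>2 dvd py (int a) (i * q)"
    using i n unfolding q by (simp only: pell_def power2_eq_square of_nat_mult)
  then have "int y dvd int q" unfolding py_square_dvd_iff using i y by (auto simp: pell_def)
  then have "int y dvd int n" unfolding q by simp
  then have yn: "4 * int y dvd 4 * int n" by simp
  have ji': "4 * int y dvd int j - int i \<or> 4 * int y dvd int j + int i"
    using ji yn dvd_trans by blast
  have "int (4 * y) dvd int b - int 1" using b(1) by (simp only: cong_int_iff[symmetric] cong_iff_dvd_diff)
  then have "int (4 * y) dvd int b - 1" by simp
  from dvd_trans[OF this py_cong_index] have tj: "int (4 * y) dvd int t - int j"
    using j by (simp add: pell_def)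
  have "int (4 * y) dvd int t - int k" using tk by (simp only: cong_int_iff[symmetric] cong_iff_dvd_diff)
  from dvd_diff[OF this tj] have jk: "4 * int y dvd int j - int k" by simp
  have iy: "i \<le> y" using i py_ge[of "int a" i] a by (simp add: pell_def)
  have "i = k"
    using ji'
  proof
    assume "4 * int y dvd int j - int i"
    from dvd_diff[OF this jk] have d: "4 * int y dvd int k - int i" by simp
    have "\<bar>int k - int i\<bar> < 4 * int y" using iy ky y by linarith
    then have "\<not> \<bar>4 * int y\<bar> \<le> \<bar>int k - int i\<bar>" by simp
    with d have "int k - int i = 0" using dvd_imp_le_int by blast
    then show ?thesis by simp
  next
    assume "4 * int y dvd int j + int i"
    from dvd_diff[OF this jk] have "4 * int y dvd int k + int i" by (simp add: add.commute)
    moreover have "0 < int k + int i" "int k + int i < 4 * int y" using iy ky y k by linarith+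
    ultimately show ?thesis using zdvd_not_zless by blast
  qed
  with i show "pell a k x y" by simp
qed

lemma pell_0: "pell a 0 x y \<longleftrightarrow> x = 1 \<and> y = 0"
  by (auto simp: pell_def)

theorem power_pell:
  assumes n: "1 \<le> n"
  shows "m = n ^ k \<longleftrightarrow> (\<exists>A B X Y M. pell (n + 3) (k + 1) A B \<and> pell (B + n + 3) k X Y \<and>
    M + n * n + 1 = 2 * (B + n + 3) * n \<and> m < M \<and> [X = Y * (B + 3) + m] (mod M))"
proof -
  have *: "[X = Y * (B + 3) + n ^ k] (mod M)" "n ^ k < M"
    if pell: "pell (n + 3) (k + 1) A B" "pell (B + n + 3) k X Y"
      and M: "M + n * n + 1 = 2 * (B + n + 3) * n" for A B X Y M
  proof -
    have "int n ^ k \<le> (int n + 3) ^ k" by (intro power_mono) auto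
    also have "\<dots> \<le> int B" using py_Suc_ge_power[of "int n + 3" k] pell(1) by (simp add: pell_def add.commute)
    finally have "n ^ k \<le> B" by (simp flip: of_nat_power)
    moreover have "B < M"
    proof -
      have "B * 1 \<le> B * n" "1 * 1 \<le> n * n" using n by (intro mult_le_mono; simp)+
      moreover have "M + n * n + 1 = 2 * (B * n) + 2 * (n * n) + 6 * n" using M by (simp add: algebra_simps)
      ultimately show ?thesis using n by linarith
    qed
    ultimately show "n ^ k < M" by simp
    have "int (M + n * n + 1) = int (2 * (B + n + 3) * n)" using M by (rule arg_cong)
    then have "int M = 2 * int (B + n + 3) * int n - int n * int n - 1" by simp
    then have "int M dvd int X - (int (B + n + 3) - int n) * int Y - int n ^ k"
      using px_cong_power[of "int (B + n + 3)" "int n" k] pell(2) unfolding pell_def by (simp only:)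
    then have "int M dvd int X - int (Y * (B + 3) + n ^ k)" by (simp add: algebra_simps)
    then show "[X = Y * (B + 3) + n ^ k] (mod M)" by (simp only: cong_int_iff[symmetric] cong_iff_dvd_diff)
  qed
  show ?thesis
  proof
    assume m: "m = n ^ k"
    obtain A B where AB: "pell (n + 3) (k + 1) A B" using pell_exists[of "n + 3" "k + 1"] by auto
    obtain X Y where XY: "pell (B + n + 3) k X Y" using pell_exists[of "B + n + 3" k] by auto
    have "n * 1 \<le> n * n" "1 * 1 \<le> n * n" using n by (intro mult_le_mono; simp)+
    then have "n * n + 1 \<le> 2 * (B + n + 3) * n" by (simp add: algebra_simps)
    then obtain M where M: "M + n * n + 1 = 2 * (B + n + 3) * n"
      by (metis add.assoc add.commute le_Suc_ex)
    show "\<exists>A B X Y M. pell (n + 3) (k + 1) A B \<and> pell (B + n + 3) k X Y \<and>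
      M + n * n + 1 = 2 * (B + n + 3) * n \<and> m < M \<and> [X = Y * (B + 3) + m] (mod M)"
      using AB XY M *[OF AB XY M] unfolding m by blast
  next
    assume "\<exists>A B X Y M. pell (n + 3) (k + 1) A B \<and> pell (B + n + 3) k X Y \<and>
      M + n * n + 1 = 2 * (B + n + 3) * n \<and> m < M \<and> [X = Y * (B + 3) + m] (mod M)"
    then obtain A B X Y M where AB: "pell (n + 3) (k + 1) A B" and XY: "pell (B + n + 3) k X Y"
      and M: "M + n * n + 1 = 2 * (B + n + 3) * n" and m: "m < M" "[X = Y * (B + 3) + m] (mod M)"
      by blast
    have "[Y * (B + 3) + m = Y * (B + 3) + n ^ k] (mod M)"
      using m(2) *(1)[OF AB XY M] by (metis cong_sym cong_trans)
    then have "[m = n ^ k] (mod M)" by (simp only: cong_add_lcancel_nat)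
    then show "m = n ^ k" using m(1) *(2)[OF AB XY M] by (simp add: cong_less_modulus_unique_nat)
  qed
qed

lemma sum_digits_less:
  assumes "\<And>i. d i < (u::nat)" shows "(\<Sum>i<k. d i * u ^ i) < u ^ k"
proof (induction k)
  case (Suc k)
  have "Suc (d k) * u ^ k \<le> u * u ^ k" using assms[of k] by (intro mult_right_mono) auto
  with Suc show ?case by simp
qed simp

lemma sum_digits_split:
  "(\<Sum>i<k + 1 + j. d i * u ^ i)
     = (\<Sum>i<j. d (k + 1 + i) * u ^ i) * u ^ (k + 1) + d k * u ^ k + (\<Sum>i<k. d i * (u::nat) ^ i)"
  by (induction j) (simp_all add: algebra_simps power_add)

theorem binomial_digit:
  defines "u n \<equiv> 2 ^ n + (1::nat)"
  shows "m = n choose k \<longleftrightarrow>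
    (\<exists>h l. (u n + 1) ^ n = h * u n ^ (k + 1) + m * u n ^ k + l \<and> l < u n ^ k \<and> m < u n)"
proof -
  let ?u = "u n"
  have digit: "n choose i < ?u" for i
    using binomial_le_pow2[of n i] by (simp add: u_def less_Suc_eq_le)
  have "(?u + 1) ^ n = (\<Sum>i\<le>n. (n choose i) * ?u ^ i)" by (subst binomial) (simp add: mult.commute)
  also have "\<dots> = (\<Sum>i<k + 1 + n. (n choose i) * ?u ^ i)"
    by (intro sum.mono_neutral_left) auto
  finally have ex: "(?u + 1) ^ n = (\<Sum>i<n. (n choose (k + 1 + i)) * ?u ^ i) * ?u ^ (k + 1)
      + (n choose k) * ?u ^ k + (\<Sum>i<k. (n choose i) * ?u ^ i)"
    unfolding sum_digits_split .
  have less: "(\<Sum>i<k. (n choose i) * ?u ^ i) < ?u ^ k" using digit by (rule sum_digits_less)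
  have unique: "m = m'" if "h * ?u ^ (k + 1) + m * ?u ^ k + l = h' * ?u ^ (k + 1) + m' * ?u ^ k + l'"
    "l < ?u ^ k" "l' < ?u ^ k" "m < ?u" "m' < ?u" for h h' m m' l l'
  proof -
    have d: "(h * ?u ^ (k + 1) + m * ?u ^ k + l) div ?u ^ k mod ?u = m"
      if "l < ?u ^ k" "m < ?u" for h m l
    proof -
      have "h * ?u ^ (k + 1) + m * ?u ^ k + l = l + (m + h * ?u) * ?u ^ k" by (simp add: algebra_simps)
      then show ?thesis using that by (simp add: div_mult_self1)
    qed
    show ?thesis using d[of l m h] d[of l' m' h'] that by metis
  qed
  show ?thesis
  proof
    assume "m = n choose k"
    then show "\<exists>h l. (?u + 1) ^ n = h * ?u ^ (k + 1) + m * ?u ^ k + l \<and> l < ?u ^ k \<and> m < ?u"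
      using ex less digit by blast
  next
    assume "\<exists>h l. (?u + 1) ^ n = h * ?u ^ (k + 1) + m * ?u ^ k + l \<and> l < ?u ^ k \<and> m < ?u"
    then obtain h l where "(?u + 1) ^ n = h * ?u ^ (k + 1) + m * ?u ^ k + l" "l < ?u ^ k" "m < ?u"
      by blast
    then show "m = n choose k" using unique[OF trans[OF sym] _ less _ digit] ex by blast
  qed
qed

lemma fact_binomial_Suc: "fact (Suc n) * (r choose Suc n) = fact n * (r choose n) * (r - n)"
proof -
  have "Suc n * (r choose Suc n) = (r - n) * (r choose n)"
    by (metis binomial_absorption binomial_absorb_comp)
  moreover have "fact (Suc n) * (r choose Suc n) = fact n * (Suc n * (r choose Suc n))"
    unfolding fact_Suc by (simp only: of_nat_id ac_simps)
  ultimately show ?thesis by (simp only: ac_simps)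
qed

lemma fact_binomial_le: "fact n * (r choose n) \<le> r ^ n"
proof (induction n)
  case (Suc n)
  have "fact n * (r choose n) * (r - n) \<le> r ^ n * r" using Suc by (intro mult_le_mono) auto
  then show ?case unfolding fact_binomial_Suc by (simp add: mult.commute)
qed simp

lemma fact_binomial_ge:
  assumes "n \<le> r"
  shows "r * r ^ n \<le> r * (fact n * (r choose n)) + n * n * r ^ n"
  using assms
proof (induction n)
  case (Suc n)
  define F where "F = fact n * (r choose n)"
  obtain d where d: "r = n + d" using Suc.prems by (metis Suc_leD le_iff_add)
  have IH: "r * r ^ n \<le> r * F + n * n * r ^ n" using Suc by (simp add: F_def)
  have "r * (r * r ^ n) = r * r ^ n * d + n * (r * r ^ n)" by (simp add: d algebra_simps)
  also have "\<dots> \<le> (r * F + n * n * r ^ n) * d + n * (r * r ^ n)" using IH by (intro add_mono mult_right_mono) auto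
  also have "\<dots> \<le> r * (F * d) + n * n * (r * r ^ n) + n * (r * r ^ n)"
    by (simp add: d algebra_simps)
  also have "\<dots> \<le> r * (F * d) + Suc n * Suc n * (r * r ^ n)" by (simp add: algebra_simps)
  finally show ?case unfolding fact_binomial_Suc F_def[symmetric] by (simp add: d)
qed simp

theorem fact_as_quotient:
  assumes r: "n * n * (n ^ n + 1) < r"
  shows "fact n = r ^ n div (r choose n)"
proof -
  have "n * 1 \<le> n * n" by (cases n) auto
  also have "\<dots> * 1 \<le> n * n * (n ^ n + 1)" by (intro mult_le_mono) auto
  finally have nr: "n \<le> r" using r by simp
  have fn: "fact n \<le> n ^ n" using fact_le_power[of n, where ?'a = nat] by simp
  define N C P where "N = (fact n :: nat)" and "C = r choose n" and "P = r ^ n"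
  have "n * n * (N + 1) < r"
    using r mult_le_mono2[of "N + 1" "n ^ n + 1" "n * n"] fn unfolding N_def by linarith
  moreover have "0 < P" using r by (simp add: P_def)
  ultimately have 1: "P * (n * n * (N + 1)) < P * r" by (rule mult_strict_left_mono)
  have "r * P \<le> r * (N * C) + n * n * P"
    using fact_binomial_ge[OF nr] by (simp only: N_def C_def P_def)
  then have 2: "(N + 1) * (r * P) \<le> (N + 1) * (r * (N * C) + n * n * P)" by (rule mult_le_mono2)
  have 3: "(N + 1) * (r * P) = r * (N * P) + P * r" by (simp add: algebra_simps)
  have 4: "(N + 1) * (r * (N * C) + n * n * P) = r * (N * ((N + 1) * C)) + P * (n * n * (N + 1))"
    by (simp add: algebra_simps)
  from 1 2[unfolded 3 4] have "r * (N * P) < r * (N * ((N + 1) * C))" by linarith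
  then have "P < (N + 1) * C" unfolding mult_less_cancel1 by blast
  moreover have "N * C \<le> P" unfolding N_def C_def P_def by (rule fact_binomial_le)
  ultimately have "P div C = N"
    by (intro div_nat_eqI) (simp_all only: mult.commute[of _ C] Suc_eq_plus1)
  then show ?thesis unfolding N_def C_def P_def by (rule sym)
qed

section \<open>Diophantine predicates\<close>

datatype pol = Par nat | Wit nat | Con nat | Add pol pol | Mul pol pol

primrec peval :: "pol \<Rightarrow> (nat \<Rightarrow> nat) \<Rightarrow> (nat \<Rightarrow> nat) \<Rightarrow> nat" where
  "peval (Par i) v w = v i"
| "peval (Wit i) v w = w i"
| "peval (Con c) v w = c"
| "peval (Add p q) v w = peval p v w + peval q v w"
| "peval (Mul p q) v w = peval p v w * peval q v w"

primrec psubst :: "(nat \<Rightarrow> pol) \<Rightarrow> (nat \<Rightarrow> pol) \<Rightarrow> pol \<Rightarrow> pol" where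
  "psubst f g (Par i) = f i"
| "psubst f g (Wit i) = g i"
| "psubst f g (Con c) = Con c"
| "psubst f g (Add p q) = Add (psubst f g p) (psubst f g q)"
| "psubst f g (Mul p q) = Mul (psubst f g p) (psubst f g q)"

primrec pbound :: "pol \<Rightarrow> nat" where
  "pbound (Par i) = Suc i"
| "pbound (Wit i) = Suc i"
| "pbound (Con c) = 0"
| "pbound (Add p q) = max (pbound p) (pbound q)"
| "pbound (Mul p q) = max (pbound p) (pbound q)"

lemma peval_psubst:
  "peval (psubst f g p) v w = peval p (\<lambda>i. peval (f i) v w) (\<lambda>i. peval (g i) v w)"
  by (induction p) simp_all

lemma peval_cong:
  "(\<And>i. i < pbound p \<Longrightarrow> v i = v' i \<and> w i = w' i) \<Longrightarrow> peval p v w = peval p v' w'"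
  by (induction p) simp_all

lemma peval_mono:
  "(\<And>i. i < pbound p \<Longrightarrow> v i \<le> v' i \<and> w i \<le> w' i) \<Longrightarrow> peval p v w \<le> peval p v' w'"
  by (induction p) (simp_all add: add_mono mult_mono)

definition dioph :: "((nat \<Rightarrow> nat) \<Rightarrow> bool) \<Rightarrow> bool" where
  "dioph P \<longleftrightarrow> (\<exists>p q. \<forall>v. P v \<longleftrightarrow> (\<exists>w. peval p v w = peval q v w))"

definition dfun :: "((nat \<Rightarrow> nat) \<Rightarrow> nat) \<Rightarrow> bool" where
  "dfun f \<longleftrightarrow> dioph (\<lambda>v. v 0 = f (\<lambda>i. v (Suc i)))"

lemma diophI: "(\<And>v. P v \<longleftrightarrow> (\<exists>w. peval p v w = peval q v w)) \<Longrightarrow> dioph P"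
  unfolding dioph_def by blast

lemma diophE:
  assumes "dioph P"
  obtains p q where "\<forall>v. P v \<longleftrightarrow> (\<exists>w. peval p v w = peval q v w)"
  using assms unfolding dioph_def by blast

definition merge :: "(nat \<Rightarrow> nat) \<Rightarrow> (nat \<Rightarrow> nat) \<Rightarrow> nat \<Rightarrow> nat" where
  "merge a b i = (if even i then a (i div 2) else b (i div 2))"

lemma merge_simps [simp]: "merge a b (2 * i) = a i" "merge a b (Suc (2 * i)) = b i"
  by (simp_all add: merge_def)

lemma sum_squares_eq_iff:
  "a * a + b * b + (c * c + d * d) = 2 * (a * b) + 2 * (c * d) \<longleftrightarrow> a = b \<and> c = (d::nat)"
proof -
  have "a * a + b * b + (c * c + d * d) = 2 * (a * b) + 2 * (c * d) \<longleftrightarrow>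
      int (a * a + b * b + (c * c + d * d)) = int (2 * (a * b) + 2 * (c * d))"
    by (simp only: of_nat_eq_iff)
  also have "\<dots> \<longleftrightarrow> (int a - int b)\<^sup>2 + (int c - int d)\<^sup>2 = 0"
    by (simp add: power2_eq_square algebra_simps)
  also have "\<dots> \<longleftrightarrow> a = b \<and> c = d" by (simp add: sum_power2_eq_zero_iff)
  finally show ?thesis .
qed

lemma prod_differences_eq_iff:
  "a * c + b * d = a * d + b * c \<longleftrightarrow> a = b \<or> c = (d::nat)"
proof -
  have "a * c + b * d = a * d + b * c \<longleftrightarrow> int (a * c + b * d) = int (a * d + b * c)"
    by (simp only: of_nat_eq_iff)
  also have "\<dots> \<longleftrightarrow> (int a - int b) * (int c - int d) = 0" by (simp add: algebra_simps)
  finally show ?thesis by simp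
qed

lemma dioph_ex_merge:
  assumes "dioph P" shows "dioph (\<lambda>v. \<exists>a. P (merge a v))"
proof -
  obtain p q where pq: "\<forall>v. P v \<longleftrightarrow> (\<exists>w. peval p v w = peval q v w)" using assms by (rule diophE)
  let ?s = "psubst (\<lambda>i. if even i then Wit (2 * (i div 2)) else Par (i div 2)) (\<lambda>i. Wit (Suc (2 * i)))"
  have *: "(\<lambda>i. peval (if even i then Wit (2 * (i div 2)) else Par (i div 2)) v w)
      = merge (\<lambda>i. w (2 * i)) v" for v w
    by (rule ext) (simp add: merge_def)
  show ?thesis
  proof (rule diophI[of _ "?s p" "?s q"])
    fix v
    have "(\<exists>a. P (merge a v)) \<longleftrightarrow> (\<exists>a w. peval p (merge a v) w = peval q (merge a v) w)"
      by (simp add: pq)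
    also have "\<dots> \<longleftrightarrow> (\<exists>w. peval p (merge (\<lambda>i. w (2 * i)) v) (\<lambda>i. w (Suc (2 * i)))
        = peval q (merge (\<lambda>i. w (2 * i)) v) (\<lambda>i. w (Suc (2 * i))))" (is "(\<exists>a w. ?E a w) \<longleftrightarrow> ?R")
    proof
      assume "\<exists>a w. ?E a w"
      then obtain a w where "?E a w" by blast
      then show ?R by (intro exI[of _ "merge a w"]) simp
    qed blast
    finally show "(\<exists>a. P (merge a v)) \<longleftrightarrow> (\<exists>w. peval (?s p) v w = peval (?s q) v w)"
      by (simp only: peval_psubst * peval.simps)
  qed
qed

lemma dioph_rename:
  assumes "dioph P" shows "dioph (\<lambda>v. P (\<lambda>i. v (\<sigma> i)))"
proof -
  obtain p q where "\<forall>v. P v \<longleftrightarrow> (\<exists>w. peval p v w = peval q v w)" using assms by (rule diophE)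
  then show ?thesis
    by (intro diophI[of _ "psubst (\<lambda>i. Par (\<sigma> i)) Wit p" "psubst (\<lambda>i. Par (\<sigma> i)) Wit q"])
      (simp add: peval_psubst)
qed

lemma dioph_conj:
  assumes "dioph P" "dioph Q" shows "dioph (\<lambda>v. P v \<and> Q v)"
proof -
  obtain p q where pq: "\<forall>v. P v \<longleftrightarrow> (\<exists>w. peval p v w = peval q v w)" using assms(1) by (rule diophE)
  obtain r s where rs: "\<forall>v. Q v \<longleftrightarrow> (\<exists>w. peval r v w = peval s v w)" using assms(2) by (rule diophE)
  define l where "l = psubst Par (\<lambda>i. Wit (2 * i))"
  define m where "m = psubst Par (\<lambda>i. Wit (Suc (2 * i)))"
  have lm: "peval (l t) v w = peval t v (\<lambda>i. w (2 * i))"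
    "peval (m t) v w = peval t v (\<lambda>i. w (Suc (2 * i)))" for t v w
    by (simp_all add: l_def m_def peval_psubst)
  show ?thesis
  proof (rule diophI)
    fix v
    show "P v \<and> Q v \<longleftrightarrow> (\<exists>w.
      peval (Add (Add (Mul (l p) (l p)) (Mul (l q) (l q))) (Add (Mul (m r) (m r)) (Mul (m s) (m s)))) v w =
      peval (Add (Mul (Con 2) (Mul (l p) (l q))) (Mul (Con 2) (Mul (m r) (m s)))) v w)"
      unfolding peval.simps sum_squares_eq_iff lm pq[rule_format] rs[rule_format]
    proof
      assume "(\<exists>w. peval p v w = peval q v w) \<and> (\<exists>w. peval r v w = peval s v w)"
      then obtain w w' where "peval p v w = peval q v w" "peval r v w' = peval s v w'" by blast
      then show "\<exists>w. peval p v (\<lambda>i. w (2 * i)) = peval q v (\<lambda>i. w (2 * i)) \<and>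
          peval r v (\<lambda>i. w (Suc (2 * i))) = peval s v (\<lambda>i. w (Suc (2 * i)))"
        by (intro exI[of _ "merge w w'"]) simp
    qed blast
  qed
qed

lemma dioph_disj:
  assumes "dioph P" "dioph Q" shows "dioph (\<lambda>v. P v \<or> Q v)"
proof -
  obtain p q where pq: "\<forall>v. P v \<longleftrightarrow> (\<exists>w. peval p v w = peval q v w)" using assms(1) by (rule diophE)
  obtain r s where rs: "\<forall>v. Q v \<longleftrightarrow> (\<exists>w. peval r v w = peval s v w)" using assms(2) by (rule diophE)
  show ?thesis
    by (rule diophI[of _ "Add (Mul p r) (Mul q s)" "Add (Mul p s) (Mul q r)"])
      (auto simp: prod_differences_eq_iff pq rs)
qed

lemma dioph_ex:
  assumes "dioph (\<lambda>v. P (v 0) (\<lambda>i. v (Suc i)))" shows "dioph (\<lambda>v. \<exists>x. P x v)"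
proof -
  have "dioph (\<lambda>v. P (v (0::nat)) (\<lambda>i. v (Suc (2 * i))))"
    using dioph_rename[OF assms, of "\<lambda>i. case i of 0 \<Rightarrow> 0 | Suc j \<Rightarrow> Suc (2 * j)"] by simp
  from dioph_ex_merge[OF this] have "dioph (\<lambda>v. \<exists>a. P (a (0::nat)) v)" by (simp add: merge_def)
  moreover have "(\<exists>a::nat \<Rightarrow> nat. P (a 0) v) \<longleftrightarrow> (\<exists>x. P x v)" for v
    by (auto intro: exI[of "\<lambda>a::nat \<Rightarrow> nat. P (a 0) v" "\<lambda>_. x" for x])
  ultimately show ?thesis by simp
qed

lemma dioph_const: "dioph (\<lambda>v. b)"
  by (rule diophI[of _ "Con 0" "Con (if b then 0 else 1)"]) simp

lemma dioph_ball:
  fixes m :: nat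
  assumes "\<And>i. i < m \<Longrightarrow> dioph (P i)" shows "dioph (\<lambda>v. \<forall>i<m. P i v)"
  using assms
proof (induction m)
  case 0 show ?case using dioph_const[of True] by simp
next
  case (Suc m)
  then have "dioph (\<lambda>v. P m v \<and> (\<forall>i<m. P i v))" by (intro dioph_conj) auto
  then show ?case by (simp add: All_less_Suc)
qed

lemma dioph_depends_finite:
  assumes "dioph P" obtains m where "\<And>v v'. (\<And>i. i < m \<Longrightarrow> v i = v' i) \<Longrightarrow> P v \<longleftrightarrow> P v'"
proof -
  obtain p q where pq: "\<forall>v. P v \<longleftrightarrow> (\<exists>w. peval p v w = peval q v w)" using assms by (rule diophE)
  show ?thesis
  proof (rule that[of "max (pbound p) (pbound q)"])
    fix v v' :: "nat \<Rightarrow> nat" assume "\<And>i. i < max (pbound p) (pbound q) \<Longrightarrow> v i = v' i"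
    then have "peval p v w = peval p v' w" "peval q v w = peval q v' w" for w
      by (auto intro!: peval_cong)
    then show "P v \<longleftrightarrow> P v'" by (simp add: pq)
  qed
qed

lemma dioph_subst:
  assumes P: "dioph P" and F: "\<And>i. dfun (F i)"
  shows "dioph (\<lambda>v. P (\<lambda>i. F i v))"
proof -
  obtain m where m: "\<And>v v'. (\<And>i. i < m \<Longrightarrow> v i = v' i) \<Longrightarrow> P v \<longleftrightarrow> P v'"
    using dioph_depends_finite[OF P] by blast
  have "dioph (\<lambda>v. v (2 * i) = F i (\<lambda>j. v (Suc (2 * j))))" for i
    using dioph_rename[OF F[of i, unfolded dfun_def], of "\<lambda>k. case k of 0 \<Rightarrow> 2 * i | Suc j \<Rightarrow> Suc (2 * j)"]
    by simp
  then have "dioph (\<lambda>v. (\<forall>i<m. v (2 * i) = F i (\<lambda>j. v (Suc (2 * j)))) \<and> P (\<lambda>i. v (2 * i)))"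
    using dioph_rename[OF P, of "\<lambda>i. 2 * i"] by (intro dioph_conj dioph_ball)
  from dioph_ex_merge[OF this] have "dioph (\<lambda>v. \<exists>a. (\<forall>i<m. a i = F i v) \<and> P a)" by simp
  moreover have "(\<exists>a. (\<forall>i<m. a i = F i v) \<and> P a) \<longleftrightarrow> P (\<lambda>i. F i v)" for v
  proof
    assume "\<exists>a. (\<forall>i<m. a i = F i v) \<and> P a"
    then obtain a where "\<forall>i<m. a i = F i v" "P a" by blast
    then show "P (\<lambda>i. F i v)" using m[of a "\<lambda>i. F i v"] by simp
  qed (rule exI[of _ "\<lambda>i. F i v"], simp)
  ultimately show ?thesis by simp
qed

lemma dfun_tail: "dfun f \<Longrightarrow> dfun (\<lambda>v. f (\<lambda>i. v (Suc i)))"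
  unfolding dfun_def
  by (drule dioph_rename[of _ "\<lambda>i. case i of 0 \<Rightarrow> 0 | Suc j \<Rightarrow> Suc (Suc j)"]) simp

lemma dfun_var: "dfun (\<lambda>v. v i)"
  unfolding dfun_def by (rule diophI[of _ "Par 0" "Par (Suc i)"]) simp

lemma dfun_const: "dfun (\<lambda>v. c)"
  unfolding dfun_def by (rule diophI[of _ "Par 0" "Con c"]) simp

lemma dioph_rel2:
  assumes "dioph (\<lambda>v. R (v 0) (v 1))" "dfun f" "dfun g" shows "dioph (\<lambda>v. R (f v) (g v))"
  using dioph_subst[OF assms(1), of "\<lambda>i. if i = 0 then f else g"] assms(2,3) by simp

lemma dioph_rel3:
  assumes "dioph (\<lambda>v. R (v 0) (v 1) (v 2))" "dfun f" "dfun g" "dfun h"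
  shows "dioph (\<lambda>v. R (f v) (g v) (h v))"
  using dioph_subst[OF assms(1), of "\<lambda>i. if i = 0 then f else if i = 1 then g else h"] assms(2-) by simp

lemma dioph_rel4:
  assumes "dioph (\<lambda>v. R (v 0) (v 1) (v 2) (v 3))" "dfun f" "dfun g" "dfun h" "dfun k"
  shows "dioph (\<lambda>v. R (f v) (g v) (h v) (k v))"
  using dioph_subst[OF assms(1), of "\<lambda>i. if i = 0 then f else if i = 1 then g else if i = 2 then h else k"]
    assms(2-) by simp

lemma dfun_op1:
  assumes "dioph (\<lambda>v. v 0 = h (v 1))" "dfun f" shows "dfun (\<lambda>v. h (f v))"
  unfolding dfun_def
  by (rule dioph_rel2[of "\<lambda>x y. x = h y", OF assms(1) dfun_var dfun_tail[OF assms(2)]])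

lemma dfun_op2:
  assumes "dioph (\<lambda>v. v 0 = h (v 1) (v 2))" "dfun f" "dfun g" shows "dfun (\<lambda>v. h (f v) (g v))"
  unfolding dfun_def
  by (rule dioph_rel3[of "\<lambda>x y z. x = h y z", OF assms(1) dfun_var dfun_tail[OF assms(2)] dfun_tail[OF assms(3)]])

lemma dioph_eq: "dfun f \<Longrightarrow> dfun g \<Longrightarrow> dioph (\<lambda>v. f v = g v)"
  by (rule dioph_rel2[of "(=)"], rule diophI[of _ "Par 0" "Par 1"]) simp_all

lemma dfun_add: "dfun f \<Longrightarrow> dfun g \<Longrightarrow> dfun (\<lambda>v. f v + g v)"
  by (rule dfun_op2[of "(+)"], rule diophI[of _ "Par 0" "Add (Par 1) (Par 2)"]) simp_all

lemma dfun_mult: "dfun f \<Longrightarrow> dfun g \<Longrightarrow> dfun (\<lambda>v. f v * g v)"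
  by (rule dfun_op2[of "(*)"], rule diophI[of _ "Par 0" "Mul (Par 1) (Par 2)"]) simp_all

lemma dfun_Suc: "dfun f \<Longrightarrow> dfun (\<lambda>v. Suc (f v))"
  using dfun_add[OF _ dfun_const[of 1], of f] by simp

lemmas dioph_basic_rules = dioph_ex dioph_conj dioph_disj dioph_eq
  dfun_var dfun_const dfun_add dfun_mult dfun_Suc

lemma dioph_le: "dfun f \<Longrightarrow> dfun g \<Longrightarrow> dioph (\<lambda>v. f v \<le> g v)"
  by (rule dioph_rel2[of "(\<le>)"], unfold le_iff_add) (intro dioph_basic_rules)

lemma dioph_less: "dfun f \<Longrightarrow> dfun g \<Longrightarrow> dioph (\<lambda>v. f v < g v)"
  unfolding Suc_le_eq[symmetric] by (intro dioph_le dfun_Suc)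

lemma dioph_dvd: "dfun f \<Longrightarrow> dfun g \<Longrightarrow> dioph (\<lambda>v. f v dvd g v)"
  by (rule dioph_rel2[of "(dvd)"], unfold dvd_def) (intro dioph_basic_rules)

lemma dioph_cong: "dfun f \<Longrightarrow> dfun g \<Longrightarrow> dfun m \<Longrightarrow> dioph (\<lambda>v. [f v = g v] (mod m v))"
  by (rule dioph_rel3[of "\<lambda>a b m. [a = b] (mod m)"], unfold cong_iff_lin_nat)
    (intro dioph_basic_rules)

lemmas dioph_rules = dioph_basic_rules dioph_le dioph_less dioph_dvd dioph_cong

lemma dioph_pell:
  assumes "dfun a" "dfun k" "dfun x" "dfun y" "\<And>v. 3 \<le> a v"
  shows "dioph (\<lambda>v. pell (a v) (k v) (x v) (y v))"
proof -
  have eq: "3 \<le> a \<and> pell a k x y \<longleftrightarrow> 3 \<le> a \<and> (k = 0 \<and> x = 1 \<and> y = 0 \<or>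
    1 \<le> k \<and> pell_conic a x y \<and> k \<le> y \<and>
    (\<exists>u v s t b. pell_conic a u v \<and> pell_conic b s t \<and> 0 < v \<and> y * y dvd v \<and> 2 \<le> b \<and>
      [b = 1] (mod 4 * y) \<and> [b = a] (mod u) \<and> [s = x] (mod u) \<and> [t = k] (mod 4 * y)))" for a k x y
  proof (cases "3 \<le> a \<and> 1 \<le> k")
    case True
    then show ?thesis by (simp add: matiyasevich_pell)
  next
    case False
    then show ?thesis using pell_0[of a x y] by (cases "k = 0") auto
  qed
  have "dioph (\<lambda>v. 3 \<le> v 0 \<and> pell (v 0) (v 1) (v 2) (v 3))"
    unfolding eq pell_conic_def by (intro dioph_rules)
  from dioph_rel4[of "\<lambda>a k x y. 3 \<le> a \<and> pell a k x y", OF this assms(1-4)]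
  show ?thesis by (simp add: assms(5))
qed

lemma dfun_power:
  assumes "dfun f" "dfun g" shows "dfun (\<lambda>v. f v ^ g v)"
proof (rule dfun_op2[of "(^)", OF _ assms])
  have eq: "m = n ^ k \<longleftrightarrow> (n = 0 \<and> k = 0 \<and> m = 1 \<or> n = 0 \<and> 1 \<le> k \<and> m = 0 \<or> 1 \<le> n \<and>
    (\<exists>A B X Y M. pell (n + 3) (k + 1) A B \<and> pell (B + n + 3) k X Y \<and>
    M + n * n + 1 = 2 * (B + n + 3) * n \<and> m < M \<and> [X = Y * (B + 3) + m] (mod M)))" for m n k
    using power_pell[of n m k] by (cases "n = 0"; cases "k = 0") (simp_all add: zero_power)
  show "dioph (\<lambda>v. v 0 = v 1 ^ v 2)"
    unfolding eq by (intro dioph_rules dioph_pell) simp_all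
qed

lemma dfun_binomial:
  assumes "dfun f" "dfun g" shows "dfun (\<lambda>v. f v choose g v)"
  by (rule dfun_op2[of "(choose)", OF _ assms], unfold binomial_digit)
    (intro dioph_rules dfun_power)

lemma dfun_div:
  assumes "dfun f" "dfun g" shows "dfun (\<lambda>v. f v div g v)"
proof (rule dfun_op2[of "(div)", OF _ assms])
  have eq: "q = m div n \<longleftrightarrow> (n = 0 \<and> q = 0 \<or> (\<exists>r. r < n \<and> m = q * n + r))" for q m n :: nat
  proof (cases "n = 0")
    case False
    then have "m mod n < n \<and> m = m div n * n + m mod n" by simp
    moreover have "q = m div n" if "r < n" "m = q * n + r" for r using that False by simp
    ultimately show ?thesis using False by blast
  qed simp
  show "dioph (\<lambda>v. v 0 = v 1 div v 2)" unfolding eq by (intro dioph_rules)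
qed

lemma dfun_mod:
  assumes "dfun f" "dfun g" shows "dfun (\<lambda>v. f v mod g v)"
proof (rule dfun_op2[of "(mod)", OF _ assms])
  have eq: "r = m mod n \<longleftrightarrow> m = m div n * n + r" for r m n :: nat
    using div_mult_mod_eq[of m n] by linarith
  show "dioph (\<lambda>v. v 0 = v 1 mod v 2)" unfolding eq by (intro dioph_rules dfun_div)
qed

lemma dfun_fact:
  assumes "dfun f" shows "dfun (\<lambda>v. fact (f v))"
proof -
  have "fact n = (n * n * (n ^ n + 1) + 1) ^ n div ((n * n * (n ^ n + 1) + 1) choose n)" for n :: nat
    by (rule fact_as_quotient) simp
  then show ?thesis
    by (simp only:) (intro dioph_rules dfun_div dfun_power dfun_binomial assms)
qed

section \<open>Bounded universal quantification\<close>

lemma dfun_if: "(b \<Longrightarrow> dfun f) \<Longrightarrow> (\<not> b \<Longrightarrow> dfun g) \<Longrightarrow> dfun (\<lambda>v. if b then f v else g v)"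
  by (cases b) simp_all

lemma dfun_peval:
  assumes "\<And>i. dfun (F i)" "\<And>i. dfun (G i)"
  shows "dfun (\<lambda>v. peval p (\<lambda>i. F i v) (\<lambda>i. G i v))"
  by (induction p) (simp_all add: assms dioph_rules)

lemma peval_cong_mod:
  "(\<And>i. i < pbound p \<Longrightarrow> [v i = v' i] (mod r) \<and> [w i = w' i] (mod r)) \<Longrightarrow>
    [peval p v w = peval p v' w'] (mod r)"
  by (induction p) (simp_all add: cong_add cong_mult)

lemma dioph_ex_fun:
  assumes "dioph (\<lambda>z. C (\<lambda>i. z (2 * i)) (\<lambda>i. z (Suc (2 * i))))" shows "dioph (\<lambda>v. \<exists>a. C a v)"
  using dioph_ex_merge[OF assms] by simp

text \<open>Moduli for the Chinese remainder theorem. If \<open>T\<close> is the square of a large factorial, they are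
  pairwise coprime with product the binomial coefficient \<open>n + T choose n\<close>, and
  \<open>(k + 1) * modulus T k = k + 1 + T\<close> makes the single number \<open>- 1 - T\<close> congruent to \<open>k\<close> modulo
  the \<open>k\<close>-th modulus, for all \<open>k\<close> at once.\<close>

definition modulus :: "nat \<Rightarrow> nat \<Rightarrow> nat" where
  "modulus T k = 1 + T div (k + 1)"

lemma modulus_mult: "(k + 1) dvd T \<Longrightarrow> (k + 1) * modulus T k = k + 1 + T"
  by (simp add: modulus_def distrib_left del: mult_Suc)

lemma binomial_eq_prod_modulus:
  "\<forall>k<n. (k + 1) dvd T \<Longrightarrow> (n + T choose n) = (\<Prod>k<n. modulus T k)"
proof (induction n)
  case (Suc n)
  have "(Suc n + T choose Suc n) * Suc n = Suc (n + T) * (n + T choose n)"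
    using Suc_times_binomial_eq[of "n + T" n] by simp
  also have "Suc (n + T) = (n + 1) * modulus T n" using Suc.prems by (subst modulus_mult) auto
  also have "(n + T choose n) = (\<Prod>k<n. modulus T k)" using Suc by simp
  finally have "Suc n * (Suc n + T choose Suc n) = Suc n * (\<Prod>k<Suc n. modulus T k)"
    unfolding prod.lessThan_Suc by (simp only: ac_simps Suc_eq_plus1)
  then show ?case unfolding mult_cancel1 by simp
qed simp

lemma fact_binomial_prod: "fact n * (a choose n) = (\<Prod>j<n. a - j)"
  by (induction n) (simp_all only: fact_binomial_Suc prod.lessThan_Suc, simp)

context
  fixes n Q T :: nat
  assumes n: "n \<le> Q" and T: "T = fact Q * fact Q"
begin

lemma Suc_dvd_fact: "k < n \<Longrightarrow> (k + 1) dvd fact Q"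
  using n by (intro dvd_fact) auto

lemma Suc_dvd: "k < n \<Longrightarrow> (k + 1) dvd T"
  using Suc_dvd_fact unfolding T by (rule dvd_mult2)

lemma prime_dvd_modulus_gt:
  assumes "prime r" "r dvd modulus T k" "k < n" shows "Q < r"
proof (rule ccontr)
  assume "\<not> Q < r"
  then have r: "r dvd fact Q" using prime_gt_0_nat[OF assms(1)] by (intro dvd_fact) auto
  have "T div (k + 1) = fact Q * (fact Q div (k + 1))"
    unfolding T using Suc_dvd_fact[OF assms(3)] by (rule div_mult_swap[symmetric])
  then have "r dvd T div (k + 1)" using r by simp
  with assms(2) have "r dvd 1" unfolding modulus_def using dvd_add_left_iff by blast
  with assms(1) show False by simp
qed

lemma cong_index_modulus:
  assumes "k < n" "r dvd modulus T k" "r dvd c + 1 + T" shows "[c = k] (mod r)"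
proof -
  have "r dvd k + 1 + T" using assms(2) modulus_mult[OF Suc_dvd[OF assms(1)]] by (metis dvd_mult)
  then have "[c + (1 + T) = k + (1 + T)] (mod r)"
    using assms(3) by (simp add: cong_def mod_eq_0_iff_dvd add.assoc)
  then show ?thesis by (simp only: cong_add_rcancel_nat)
qed

lemma coprime_modulus:
  assumes "k < n" "l < n" "k \<noteq> l" shows "coprime (modulus T k) (modulus T l)"
proof (rule ccontr)
  assume "\<not> ?thesis"
  then obtain r where r: "prime r" "r dvd modulus T k" "r dvd modulus T l"
    by (metis coprime_iff_gcd_eq_1 gcd_greatest_iff prime_factor_nat)
  have "r dvd l + 1 + T" using r(3) modulus_mult[OF Suc_dvd[OF assms(2)]] by (metis dvd_mult)
  then have "[l = k] (mod r)" using cong_index_modulus[OF assms(1) r(2)] by blast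
  moreover have "Q < r" using prime_dvd_modulus_gt r assms by blast
  ultimately have "l = k" using assms n by (intro cong_less_modulus_unique_nat[of l k r]) auto
  then show False using assms(3) by simp
qed

lemma cong_binomial_iff:
  "[x = y] (mod (n + T choose n)) \<longleftrightarrow> (\<forall>k<n. [x = y] (mod modulus T k))"
proof -
  have N: "(n + T choose n) = (\<Prod>k<n. modulus T k)"
    using Suc_dvd by (intro binomial_eq_prod_modulus) auto
  show ?thesis
  proof
    assume "[x = y] (mod (n + T choose n))"
    then show "\<forall>k<n. [x = y] (mod modulus T k)"
      unfolding N by (auto intro: cong_dvd_modulus_nat)
  next
    assume "\<forall>k<n. [x = y] (mod modulus T k)"
    then show "[x = y] (mod (n + T choose n))" unfolding N
      using coprime_modulus by (intro cong_cong_prod_coprime_nat) auto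
  qed
qed

lemma binomial_dvd_iff: "(n + T choose n) dvd x \<longleftrightarrow> (\<forall>k<n. modulus T k dvd x)"
  using cong_binomial_iff[of x 0] by (simp add: cong_0_iff)

end

text \<open>\<open>Q\<close> bounds both polynomials on the relevant arguments and every prime divisor of a modulus
  exceeds \<open>Q\<close>, so congruent values are equal. That some prime divides
  \<open>a (a - 1) \<dots> (a - u)\<close> says that the residue of \<open>a\<close> is at most \<open>u\<close>.\<close>

lemma bounded_all_iff:
  fixes x :: "nat \<Rightarrow> nat" and p q :: pol
  defines "m \<equiv> max (pbound p) (pbound q)"
  shows "(\<forall>k<x 0. \<exists>w. peval p (x(0 := k)) w = peval q (x(0 := k)) w) \<longleftrightarrow>
    (\<exists>a u c Q T N. Q = x 0 + u + 1 + peval p x (\<lambda>_. u) + peval q x (\<lambda>_. u) \<and>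
      T = fact Q * fact Q \<and> N = (x 0 + T choose x 0) \<and> N dvd c + 1 + T \<and>
      (\<forall>i<m. N dvd fact (Suc u) * (a i choose Suc u)) \<and>
      [peval p (x(0 := c)) a = peval q (x(0 := c)) a] (mod N))" (is "?L \<longleftrightarrow> ?R")
proof
  assume ?L
  then obtain w where w: "\<forall>k<x 0. peval p (x(0 := k)) (w k) = peval q (x(0 := k)) (w k)" by metis
  have "finite ((\<lambda>(k, i). w k i) ` ({..<x 0} \<times> {..<m}))" by simp
  then obtain u where "\<forall>y \<in> (\<lambda>(k, i). w k i) ` ({..<x 0} \<times> {..<m}). y \<le> u"
    using finite_nat_set_iff_bounded_le by blast
  then have u: "w k i \<le> u" if "k < x 0" "i < m" for k i using that by auto
  define Q where "Q = x 0 + u + 1 + peval p x (\<lambda>_. u) + peval q x (\<lambda>_. u)"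
  define T :: nat where "T = fact Q * fact Q"
  define N where "N = (x 0 + T choose x 0)"
  have nQ: "x 0 \<le> Q" by (simp add: Q_def)
  note dvdN = binomial_dvd_iff[OF nQ T_def, folded N_def]
  note congN = cong_binomial_iff[OF nQ T_def, folded N_def]
  note cop = coprime_modulus[OF nQ T_def]
  have "\<exists>y. \<forall>k\<in>{..<x 0}. [y = w k i] (mod modulus T k)" for i
    using cop by (intro chinese_remainder_nat) auto
  then have "\<forall>i. \<exists>y. \<forall>k\<in>{..<x 0}. [y = w k i] (mod modulus T k)" by blast
  from choice[OF this] obtain a where "\<forall>i. \<forall>k\<in>{..<x 0}. [a i = w k i] (mod modulus T k)" ..
  then have a: "\<And>i k. k < x 0 \<Longrightarrow> [a i = w k i] (mod modulus T k)" by simp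
  define c where "c = (1 + T) * (N - 1)"
  have "0 < N" by (simp add: N_def zero_less_binomial)
  then have "c + 1 + T = (1 + T) * N" by (cases N) (simp_all add: c_def)
  then have Nc: "N dvd c + 1 + T" by simp
  have "modulus T k dvd fact (Suc u) * (a i choose Suc u)" if "k < x 0" "i < m" for i k
  proof -
    have "modulus T k dvd a i - w k i"
      using a[OF that(1), of i] by (cases "w k i \<le> a i") (simp_all add: cong_altdef_nat)
    also have "\<dots> dvd (\<Prod>j<Suc u. a i - j)" using u[OF that] by (intro dvd_prodI) auto
    finally show ?thesis unfolding fact_binomial_prod .
  qed
  then have "\<forall>i<m. N dvd fact (Suc u) * (a i choose Suc u)" unfolding dvdN by blast
  moreover have "[peval p (x(0 := c)) a = peval q (x(0 := c)) a] (mod modulus T k)" if k: "k < x 0" for k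
  proof -
    have "modulus T k dvd c + 1 + T" using Nc k unfolding dvdN by blast
    from cong_index_modulus[OF nQ T_def k dvd_refl this]
    have *: "[peval s (x(0 := c)) a = peval s (x(0 := k)) (w k)] (mod modulus T k)" for s
      using a[OF k] by (intro peval_cong_mod) simp
    show ?thesis
      using cong_trans[OF *[of p, unfolded w[rule_format, OF k]] cong_sym[OF *[of q]]] .
  qed
  then have "[peval p (x(0 := c)) a = peval q (x(0 := c)) a] (mod N)" unfolding congN by blast
  ultimately show ?R
    by (intro exI[of _ a] exI[of _ u] exI[of _ c] exI[of _ Q] exI[of _ T] exI[of _ N] conjI
        Q_def T_def N_def Nc)
next
  assume ?R
  then obtain a u c Q T N where Q: "Q = x 0 + u + 1 + peval p x (\<lambda>_. u) + peval q x (\<lambda>_. u)"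
    and T: "T = fact Q * fact Q" and N: "N = (x 0 + T choose x 0)" and Nc: "N dvd c + 1 + T"
    and Na: "\<And>i. i < m \<Longrightarrow> N dvd fact (Suc u) * (a i choose Suc u)"
    and Np: "[peval p (x(0 := c)) a = peval q (x(0 := c)) a] (mod N)" by blast
  have nQ: "x 0 \<le> Q" by (simp add: Q)
  show ?L
  proof (intro allI impI)
    fix k assume k: "k < x 0"
    have "T \<noteq> 0" by (simp add: T)
    then have "modulus T k \<noteq> 1"
      using dvd_div_eq_0_iff[OF Suc_dvd[OF nQ T k]] unfolding modulus_def by simp
    then obtain r where r: "prime r" "r dvd modulus T k" using prime_factor_nat[of "modulus T k"] by auto
    have Qr: "Q < r" using prime_dvd_modulus_gt[OF nQ T r k] .
    have "modulus T k dvd N"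
      using iffD1[OF binomial_dvd_iff[OF nQ T, folded N] dvd_refl] k by simp
    from dvd_trans[OF r(2) this] have rN: "r dvd N" .
    define w where "w i = a i mod r" for i
    have ck: "[c = k] (mod r)"
      using cong_index_modulus[OF nQ T k r(2) dvd_trans[OF rN Nc]] .
    have w: "w i \<le> u" if "i < m" for i
    proof -
      have "r dvd (\<Prod>j<Suc u. a i - j)"
        using dvd_trans[OF rN Na[OF that]] unfolding fact_binomial_prod .
      then obtain j where j: "j < Suc u" "r dvd a i - j"
        using prime_dvd_prod_iff[OF finite_lessThan r(1)] by blast
      show ?thesis
      proof (cases "j \<le> a i")
        case True
        then have "[a i = j] (mod r)" using j(2) by (simp add: cong_altdef_nat)
        then have "a i mod r = j mod r" by (simp only: cong_def)
        then show ?thesis using j(1) mod_less_eq_dividend[of j r] unfolding w_def by linarith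
      next
        case False
        then show ?thesis using j(1) mod_less_eq_dividend[of "a i" r] unfolding w_def by linarith
      qed
    qed
    have *: "[peval s (x(0 := c)) a = peval s (x(0 := k)) w] (mod r)" for s
      using ck by (intro peval_cong_mod) (auto simp: w_def cong_def)
    have "[peval p (x(0 := k)) w = peval q (x(0 := k)) w] (mod r)"
      using cong_trans[OF cong_sym[OF *[of p]] cong_trans[OF cong_dvd_modulus_nat[OF Np rN] *[of q]]] .
    moreover have "peval p (x(0 := k)) w \<le> peval p x (\<lambda>_. u)" "peval q (x(0 := k)) w \<le> peval q x (\<lambda>_. u)"
      using w k by (auto intro!: peval_mono simp: m_def)
    ultimately have "peval p (x(0 := k)) w = peval q (x(0 := k)) w"
      using Qr Q by (intro cong_less_modulus_unique_nat) auto
    then show "\<exists>w. peval p (x(0 := k)) w = peval q (x(0 := k)) w" by blast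
  qed
qed

theorem dioph_bounded_all:
  assumes R: "dioph (\<lambda>v. R (v 0) (\<lambda>i. v (Suc i)))" and n: "dfun n"
  shows "dioph (\<lambda>v. \<forall>k<n v. R k v)"
proof -
  obtain p q where pq: "\<forall>v. R (v 0) (\<lambda>i. v (Suc i)) \<longleftrightarrow> (\<exists>w. peval p v w = peval q v w)"
    using R by (rule diophE)
  have upd: "v(0 := k) = (\<lambda>i. if i = 0 then k else v i)" for v :: "nat \<Rightarrow> nat" and k
    by auto
  have eq: "R k (\<lambda>i. x (Suc i)) \<longleftrightarrow> (\<exists>w. peval p (x(0 := k)) w = peval q (x(0 := k)) w)" for x k
    using pq[rule_format, of "x(0 := k)"] by simp
  have "dioph (\<lambda>x. \<forall>k<x 0. \<exists>w. peval p (x(0 := k)) w = peval q (x(0 := k)) w)"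
    unfolding bounded_all_iff unfolding upd
    by (intro dioph_ex_fun dioph_rules dioph_ball dfun_fact dfun_binomial dfun_peval dfun_if)
  then have "dioph (\<lambda>x. \<forall>k<x 0. R k (\<lambda>i. x (Suc i)))" unfolding eq .
  from dioph_subst[OF this, of "\<lambda>i. case i of 0 \<Rightarrow> n | Suc j \<Rightarrow> \<lambda>v. v j"]
  show ?thesis using n by (simp add: dfun_var split: nat.split)
qed

section \<open>Graphs of partial recursive functions\<close>

lemma sequence_code:
  fixes s :: "nat \<Rightarrow> nat"
  shows "\<exists>c T. \<forall>m\<le>n. c mod modulus T m = s m"
proof -
  obtain b where b: "\<forall>y \<in> s ` {..n}. y \<le> b"
    using finite_nat_set_iff_bounded_le[of "s ` {..n}"] by auto
  define Q where "Q = Suc n + b"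
  define T :: nat where "T = fact Q * fact Q"
  have nQ: "Suc n \<le> Q" by (simp add: Q_def)
  have less: "s m < modulus T m" if "m \<le> n" for m
  proof -
    have dvd: "(m + 1) dvd fact Q" using that nQ by (intro dvd_fact) auto
    have "s m \<le> b" using b that by simp
    also have "\<dots> \<le> fact Q * 1" using fact_ge_self[of Q] by (simp add: Q_def)
    also have "\<dots> \<le> fact Q * (fact Q div (m + 1))"
    proof (rule mult_le_mono2)
      have "fact Q div (m + 1) \<noteq> 0" using dvd_div_eq_0_iff[OF dvd] by simp
      then show "1 \<le> fact Q div (m + 1)" by simp
    qed
    also have "\<dots> = T div (m + 1)" unfolding T_def using dvd by (rule div_mult_swap)
    finally show ?thesis by (simp add: modulus_def)
  qed
  have "\<exists>c. \<forall>m\<in>{..n}. [c = s m] (mod modulus T m)"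
    using coprime_modulus[OF nQ T_def] by (intro chinese_remainder_nat) auto
  then obtain c where "\<forall>m\<in>{..n}. [c = s m] (mod modulus T m)" ..
  then have "\<forall>m\<le>n. c mod modulus T m = s m" using less by (simp add: cong_def)
  then show ?thesis by blast
qed

lemma dfun_modulus: "dfun f \<Longrightarrow> dfun g \<Longrightarrow> dfun (\<lambda>v. modulus (f v) (g v))"
  unfolding modulus_def by (intro dioph_rules dfun_div)

lemma dioph_subst_head:
  assumes "dioph (\<lambda>v. A (v 0) (\<lambda>i. v (Suc i)))" "dfun f"
  shows "dioph (\<lambda>v. A (f v) (\<lambda>i. v (\<sigma> i)))"
  using dioph_subst[OF assms(1), of "\<lambda>i. case i of 0 \<Rightarrow> f | Suc j \<Rightarrow> \<lambda>v. v (\<sigma> j)"] assms(2)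
  by (simp add: dfun_var split: nat.split)

lemma dioph_subst_head3:
  assumes "dioph (\<lambda>v. A (v 0) (v 1) (v 2) (\<lambda>i. v (Suc (Suc (Suc i)))))" "dfun f" "dfun g" "dfun h"
  shows "dioph (\<lambda>v. A (f v) (g v) (h v) (\<lambda>i. v (\<sigma> i)))"
  using dioph_subst[OF assms(1), of "\<lambda>i. case i of 0 \<Rightarrow> f | Suc j \<Rightarrow>
    (case j of 0 \<Rightarrow> g | Suc k \<Rightarrow> (case k of 0 \<Rightarrow> h | Suc l \<Rightarrow> \<lambda>v. v (\<sigma> l)))"] assms(2-)
  by (simp add: dfun_var numeral_2_eq_2 split: nat.split)

lemma dioph_sequence:
  assumes A: "dioph (\<lambda>v. A (v 0) (\<lambda>i. v (Suc i)))"
    and R: "dioph (\<lambda>v. R (v 0) (v 1) (v 2) (\<lambda>i. v (Suc (Suc (Suc i)))))"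
    and B: "dioph (\<lambda>v. B (v 0) (\<lambda>i. v (Suc i)))"
    and n: "dfun n"
  shows "dioph (\<lambda>v. \<exists>s. A (s 0) v \<and> (\<forall>m<n v. R m (s m) (s (Suc m)) v) \<and> B (s (n v)) v)"
proof -
  have eq: "(\<exists>s. A (s 0) v \<and> (\<forall>m<n v. R m (s m) (s (Suc m)) v) \<and> B (s (n v)) v) \<longleftrightarrow>
    (\<exists>c T. A (c mod modulus T 0) v \<and>
      (\<forall>m<n v. R m (c mod modulus T m) (c mod modulus T (Suc m)) v) \<and>
      B (c mod modulus T (n v)) v)" (is "?L \<longleftrightarrow> ?R") for v
  proof
    assume ?L
    then obtain s where s: "A (s 0) v" "\<forall>m<n v. R m (s m) (s (Suc m)) v" "B (s (n v)) v" by blast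
    obtain c T where "\<forall>m\<le>n v. c mod modulus T m = s m" using sequence_code by blast
    then show ?R using s by (intro exI[of _ c] exI[of _ T]) simp
  next
    assume ?R
    then obtain c T where "A (c mod modulus T 0) v"
      "\<forall>m<n v. R m (c mod modulus T m) (c mod modulus T (Suc m)) v" "B (c mod modulus T (n v)) v"
      by blast
    then show ?L by (intro exI[of _ "\<lambda>m. c mod modulus T m"]) simp
  qed
  note n2 = dfun_tail[OF dfun_tail[OF n]]
  show ?thesis unfolding eq
    by (intro dioph_ex dioph_conj dioph_bounded_all
        dioph_subst_head[OF A] dioph_subst_head[OF B] dioph_subst_head3[OF R]
        dfun_mod dfun_modulus dfun_var dfun_const dfun_Suc n2)
qed

lemma reval_RPrim_iff:
  "reval (RPrim f g) (n # xs) y \<longleftrightarrow>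
    (\<exists>s. reval f xs (s 0) \<and> (\<forall>m<n. reval g (m # s m # xs) (s (Suc m))) \<and> s n = y)"
proof (induction n arbitrary: y)
  case 0
  show ?case by (auto elim: reval_RPrim0E intro: prim_0)
next
  case (Suc n)
  show ?case
  proof
    assume "reval (RPrim f g) (Suc n # xs) y"
    then obtain z where "reval (RPrim f g) (n # xs) z" and z: "reval g (n # z # xs) y"
      by (rule reval_RPrimSucE)
    then obtain s where s: "reval f xs (s 0)" "\<forall>m<n. reval g (m # s m # xs) (s (Suc m))" "s n = z"
      using Suc by blast
    with z show "\<exists>s. reval f xs (s 0) \<and> (\<forall>m<Suc n. reval g (m # s m # xs) (s (Suc m))) \<and> s (Suc n) = y"
      by (intro exI[of _ "s(Suc n := y)"]) (auto simp: less_Suc_eq)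
  next
    assume "\<exists>s. reval f xs (s 0) \<and> (\<forall>m<Suc n. reval g (m # s m # xs) (s (Suc m))) \<and> s (Suc n) = y"
    then obtain s where s: "reval f xs (s 0)" "\<forall>m<Suc n. reval g (m # s m # xs) (s (Suc m))" "s (Suc n) = y"
      by blast
    then have "reval (RPrim f g) (n # xs) (s n)" using Suc by auto
    then show "reval (RPrim f g) (Suc n # xs) y" using s by (intro prim_Suc[of f g n xs "s n"]) auto
  qed
qed

lemma reval_RComp_iff:
  "reval (RComp f gs) xs z \<longleftrightarrow>
    (\<exists>a. (\<forall>i<length gs. reval (gs ! i) xs (a i)) \<and> reval f (map a [0..<length gs]) z)"
proof
  assume "reval (RComp f gs) xs z"
  then obtain ys where ys: "length ys = length gs" "\<forall>i<length gs. reval (gs ! i) xs (ys ! i)" "reval f ys z"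
    by (rule reval_RCompE)
  then show "\<exists>a. (\<forall>i<length gs. reval (gs ! i) xs (a i)) \<and> reval f (map a [0..<length gs]) z"
    by (intro exI[of _ "\<lambda>i. ys ! i"]) (simp flip: ys(1) add: map_nth)
next
  assume "\<exists>a. (\<forall>i<length gs. reval (gs ! i) xs (a i)) \<and> reval f (map a [0..<length gs]) z"
  then obtain a where "\<forall>i<length gs. reval (gs ! i) xs (a i)" "reval f (map a [0..<length gs]) z" by blast
  then show "reval (RComp f gs) xs z" by (intro comp[of "map a [0..<length gs]"]) auto
qed

lemma reval_RMu_iff:
  "reval (RMu f) xs n \<longleftrightarrow> reval f (n # xs) 0 \<and> (\<forall>m<n. \<exists>y. 0 < y \<and> reval f (m # xs) y)"
  by (auto elim: reval_RMuE intro: mu)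

theorem dioph_reval: "dioph (\<lambda>v. reval p (map v is) (v j))"
proof (induction p arbitrary: "is" j)
  case RZero
  have "reval RZero xs y \<longleftrightarrow> y = 0" for xs y by (auto elim: reval_RZeroE intro: zero)
  then show ?case by (simp only:) (intro dioph_rules)
next
  case RSucc
  have eq: "reval RSucc xs y \<longleftrightarrow> (\<exists>x. xs = [x] \<and> y = Suc x)" for xs y
    by (auto elim: reval_RSuccE intro: succ)
  show ?case
  proof (cases "\<exists>i. is = [i]")
    case True
    then obtain i where "is = [i]" ..
    then have "(reval RSucc (map v is) (v j)) \<longleftrightarrow> v j = Suc (v i)" for v by (simp add: eq)
    then show ?thesis by (simp only:) (intro dioph_rules)
  next
    case False
    then have "(reval RSucc (map v is) (v j)) \<longleftrightarrow> False" for v by (auto simp: eq)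
    then show ?thesis by (simp only:) (rule dioph_const)
  qed
next
  case (RProj i)
  have eq: "reval (RProj i) xs y \<longleftrightarrow> i < length xs \<and> y = xs ! i" for xs y
    by (auto elim: reval_RProjE intro: proj)
  show ?case
  proof (cases "i < length is")
    case True
    then have "(reval (RProj i) (map v is) (v j)) \<longleftrightarrow> v j = v (is ! i)" for v by (simp add: eq)
    then show ?thesis by (simp only:) (intro dioph_rules)
  next
    case False
    then have "(reval (RProj i) (map v is) (v j)) \<longleftrightarrow> False" for v by (simp add: eq)
    then show ?thesis by (simp only:) (rule dioph_const)
  qed
next
  case (RComp f gs)
  have f: "dioph (\<lambda>z. reval f (map (\<lambda>i. z (2 * i)) [0..<length gs]) (z (Suc (2 * j))))"
    using RComp.IH(1)[of "map (\<lambda>i. 2 * i) [0..<length gs]" "Suc (2 * j)"] by (simp add: comp_def)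
  have g: "dioph (\<lambda>z. reval (gs ! i) (map (\<lambda>i. z (Suc (2 * i))) is) (z (2 * i)))"
    if "i < length gs" for i
    using RComp.IH(2)[of "gs ! i" "map (\<lambda>i. Suc (2 * i)) is" "2 * i"] that by (simp add: comp_def)
  show ?case unfolding reval_RComp_iff
    by (intro dioph_ex_fun dioph_conj dioph_ball f g)
next
  case (RPrim f g)
  show ?case
  proof (cases "is")
    case Nil
    have "\<not> reval (RPrim f g) [] y" for y by (auto elim: reval.cases)
    then show ?thesis using dioph_const[of False] by (simp add: Nil)
  next
    case (Cons n is')
    have f: "dioph (\<lambda>v. reval f (map (\<lambda>i. v (Suc i)) is') (v 0))"
      using RPrim.IH(1)[of "map Suc is'" 0] by (simp add: comp_def)
    have g: "dioph (\<lambda>v. reval g (v 0 # v 1 # map (\<lambda>i. v (Suc (Suc (Suc i)))) is') (v 2))"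
      using RPrim.IH(2)[of "0 # 1 # map (\<lambda>i. Suc (Suc (Suc i))) is'" 2] by (simp add: comp_def)
    show ?thesis unfolding Cons list.map reval_RPrim_iff
      by (rule dioph_sequence[where A = "\<lambda>z v. reval f (map v is') z"
          and R = "\<lambda>m a b v. reval g (m # a # map v is') b" and B = "\<lambda>z v. z = v j"
          and n = "\<lambda>v. v n"]) (intro f g dioph_rules)+
  qed
next
  case (RMu f)
  have f: "dioph (\<lambda>v. reval f (v (Suc j) # map (\<lambda>i. v (Suc i)) is) (v 0))"
    using RMu.IH[of "Suc j # map Suc is" 0] by (simp add: comp_def)
  have g: "dioph (\<lambda>v. reval f (v 1 # map (\<lambda>i. v (Suc (Suc i))) is) (v 0))"
    using RMu.IH[of "1 # map (\<lambda>i. Suc (Suc i)) is" 0] by (simp add: comp_def)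
  have "reval f (v j # map v is) 0 \<longleftrightarrow> (\<exists>z. z = 0 \<and> reval f (v j # map v is) z)" for v
    by simp
  then have "dioph (\<lambda>v. reval f (v j # map v is) 0)"
    by (simp only:) (intro dioph_ex dioph_conj f dioph_rules)
  moreover have "dioph (\<lambda>v. \<exists>y. 0 < y \<and> reval f (v 0 # map (\<lambda>i. v (Suc i)) is) y)"
    using g by (intro dioph_ex dioph_conj) (simp_all add: dioph_rules)
  ultimately show ?case unfolding reval_RMu_iff
    by (intro dioph_conj dioph_bounded_all dfun_var)
qed

lemma dfun_prod_encode:
  assumes "dfun f" "dfun g" shows "dfun (\<lambda>v. prod_encode (f v, g v))"
  unfolding prod_encode_def triangle_def prod.case by (intro dioph_rules dfun_div assms)

lemma dfun_funpow:
  assumes G: "dioph (\<lambda>v. v 0 = G (v 1))" and n: "dfun n"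
  shows "dfun (\<lambda>v. (G ^^ n v) c)"
proof (rule dfun_op1[of "\<lambda>n. (G ^^ n) c", OF _ n])
  have eq: "z = (G ^^ n) c \<longleftrightarrow> (\<exists>s. s 0 = c \<and> (\<forall>m<n. s (Suc m) = G (s m)) \<and> s n = z)" for z n
  proof
    assume "z = (G ^^ n) c"
    then show "\<exists>s. s 0 = c \<and> (\<forall>m<n. s (Suc m) = G (s m)) \<and> s n = z"
      by (intro exI[of _ "\<lambda>m. (G ^^ m) c"]) simp
  next
    assume "\<exists>s. s 0 = c \<and> (\<forall>m<n. s (Suc m) = G (s m)) \<and> s n = z"
    then obtain s where s: "s 0 = c" "\<forall>m<n. s (Suc m) = G (s m)" "s n = z" by blast
    have "m \<le> n \<Longrightarrow> s m = (G ^^ m) c" for m using s by (induction m) auto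
    then show "z = (G ^^ n) c" using s(3) by blast
  qed
  show "dioph (\<lambda>v. v 0 = (G ^^ v 1) c)" unfolding eq
    by (rule dioph_sequence[where A = "\<lambda>z v. z = c" and R = "\<lambda>m a b v. b = G a"
        and B = "\<lambda>z v. z = v 0" and n = "\<lambda>v. v 1"])
      (intro dioph_rules dioph_rel2[of "\<lambda>b a. b = G a", OF G])+
qed

section \<open>Formulas counting the values of polynomials\<close>

definition copies :: "nat \<Rightarrow> ('a, 'r) core \<Rightarrow> ('a, 'r) core" where
  "copies n \<Phi> = ((\<lambda>\<Phi>'. CPlus \<Phi>' \<Phi>) ^^ n) CZero"

definition below_copies :: "nat \<Rightarrow> ('a, 'r) core \<Rightarrow> ('a, 'r) core" where
  "below_copies x \<Phi> = CSum1 0 (CIf (MNeg (MLe x 0)) \<Phi> CZero)"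

primrec pol_core :: "pol \<Rightarrow> ('a, 'r) core \<Rightarrow> ('a, 'r) core" where
  "pol_core (Par i) \<Phi> = below_copies (Suc (2 * i)) \<Phi>"
| "pol_core (Wit i) \<Phi> = below_copies (Suc (Suc (2 * i))) \<Phi>"
| "pol_core (Con c) \<Phi> = copies c \<Phi>"
| "pol_core (Add p q) \<Phi> = CPlus (pol_core p \<Phi>) (pol_core q \<Phi>)"
| "pol_core (Mul p q) \<Phi> = pol_core p (pol_core q \<Phi>)"

definition const_word :: "'r \<Rightarrow> ('a, 'r) core" where
  "const_word r = CProd 0 (SConst r)"

lemma core_sem_copies: "core_sem (copies n \<Phi>) w s S = repeat_mset n (core_sem \<Phi> w s S)"
  unfolding copies_def by (induction n) (simp_all add: add.commute)

lemma sum_const_mset: "finite A \<Longrightarrow> (\<Sum>x\<in>A. M) = repeat_mset (card A) M"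
  by (induction A rule: finite_induct) simp_all

lemma core_sem_below_copies:
  assumes "x \<noteq> 0" "s x \<in> positions w" "\<And>i. core_sem \<Phi> w (s(0 := i)) S = M"
  shows "core_sem (below_copies x \<Phi>) w (s(0 := i)) S = repeat_mset (s x - 1) M"
proof -
  have "core_sem (below_copies x \<Phi>) w (s(0 := i)) S = (\<Sum>z\<in>positions w. if z < s x then M else {#})"
    using assms by (auto simp: below_copies_def not_le intro!: sum.cong)
  also have "\<dots> = (\<Sum>z\<in>{z \<in> positions w. z < s x}. M)"
    by (rule sum.inter_filter[symmetric]) (simp add: positions_def)
  also have "{z \<in> positions w. z < s x} = {1..<s x}"
    using assms(2) by (auto simp: positions_def)
  finally show ?thesis by (simp only: sum_const_mset finite_atLeastLessThan card_atLeastLessThan)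
qed

text \<open>Positions start at 1 and variable 0 is reserved for counting, so that the \<open>i\<close>-th
  unknown is read off variable \<open>i + 1\<close> shifted by one; parameters and witnesses alternate.\<close>

definition pos_value :: "(nat \<Rightarrow> nat) \<Rightarrow> nat \<Rightarrow> nat" where
  "pos_value s i = s (Suc i) - 1"

lemma core_sem_pol_core:
  assumes "\<And>x. x \<noteq> 0 \<Longrightarrow> s x \<in> positions w" "\<And>i. core_sem \<Phi> w (s(0 := i)) S = M"
  shows "core_sem (pol_core p \<Phi>) w (s(0 := i)) S =
    repeat_mset (peval p (\<lambda>i. pos_value s (2 * i)) (\<lambda>i. pos_value s (Suc (2 * i)))) M"
  using assms(2)
proof (induction p arbitrary: \<Phi> M i)
  case (Add p q)
  show ?case
    unfolding pol_core.simps core_sem.simps Add.IH(1)[OF Add.prems] Add.IH(2)[OF Add.prems]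
    by (simp add: multiset_eq_iff distrib_right)
next
  case (Mul p q)
  show ?case
    unfolding pol_core.simps Mul.IH(1)[OF Mul.IH(2)[OF Mul.prems]]
    by (simp add: multiset_eq_iff mult.assoc)
qed (use assms(1) in \<open>simp_all add: core_sem_below_copies core_sem_copies pos_value_def del: mult_Suc\<close>)

lemma core_sem_const_word: "core_sem (const_word r) w s S = {# replicate (length w) r #}"
  by (simp add: const_word_def map_replicate_const del: upt_Suc)

lemma core_sem_pol_core_const:
  assumes "valuation w s S"
  shows "core_sem (pol_core p (const_word r)) w s S =
    replicate_mset (peval p (\<lambda>i. pos_value s (2 * i)) (\<lambda>i. pos_value s (Suc (2 * i)))) (replicate (length w) r)"
  using core_sem_pol_core[of s w "const_word r" S _ p "s 0"] assms
  by (simp add: core_sem_const_word valuation_def)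

lemma replicate_mset_pair_eq_iff:
  assumes "x \<noteq> y"
  shows "replicate_mset a x + replicate_mset b y = replicate_mset c x + replicate_mset d y \<longleftrightarrow>
    a = c \<and> b = d"
proof
  assume eq: "replicate_mset a x + replicate_mset b y = replicate_mset c x + replicate_mset d y"
  show "a = c \<and> b = d"
    using arg_cong[OF eq, of "\<lambda>M. count M x"] arg_cong[OF eq, of "\<lambda>M. count M y"] assms by simp
qed simp

definition lhs_core :: "'r \<Rightarrow> 'r \<Rightarrow> pol \<Rightarrow> ('a, 'r) core" where
  "lhs_core r r' p = CPlus (pol_core p (const_word r)) (pol_core (Par 0) (const_word r'))"

definition rhs_core :: "'r \<Rightarrow> 'r \<Rightarrow> pol \<Rightarrow> nat \<Rightarrow> ('a, 'r) core" where
  "rhs_core r r' q n = CPlus (pol_core q (const_word r)) (copies n (const_word r'))"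

lemma eq_sat_pol:
  assumes "r \<noteq> r'"
  shows "eq_sat (lhs_core r r' p :: ('a, 'r) core) (rhs_core r r' q n) \<longleftrightarrow>
    (\<exists>v w. v 0 = n \<and> peval p v w = peval q v w)"
proof -
  have sem: "core_sem (lhs_core r r' p) u s S = core_sem (rhs_core r r' q n) u s S \<longleftrightarrow>
      peval p (\<lambda>i. pos_value s (2 * i)) (\<lambda>i. pos_value s (Suc (2 * i)))
        = peval q (\<lambda>i. pos_value s (2 * i)) (\<lambda>i. pos_value s (Suc (2 * i))) \<and>
      pos_value s (2 * 0) = n"
    if "u \<noteq> []" "valuation u s S" for u :: "'a list" and s S
  proof -
    have "replicate (length u) r \<noteq> replicate (length u) r'"
      using that(1) assms by (cases u) auto
    then show ?thesis
      using core_sem_pol_core_const[OF that(2), of p r] core_sem_pol_core_const[OF that(2), of q r]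
        core_sem_pol_core_const[OF that(2), of "Par 0" r']
      by (simp add: lhs_core_def rhs_core_def core_sem_copies core_sem_const_word
          replicate_mset_pair_eq_iff del: pol_core.simps)
  qed
  show ?thesis
  proof
    assume "eq_sat (lhs_core r r' p :: ('a, 'r) core) (rhs_core r r' q n)"
    then obtain u :: "'a list" and s S where u: "u \<noteq> []" "valuation u s S"
      and eq: "core_sem (lhs_core r r' p) u s S = core_sem (rhs_core r r' q n) u s S"
      unfolding eq_sat_def by blast
    show "\<exists>v w. v 0 = n \<and> peval p v w = peval q v w"
      using iffD1[OF sem[OF u] eq]
      by (intro exI[of _ "\<lambda>i. pos_value s (2 * i)"] exI[of _ "\<lambda>i. pos_value s (Suc (2 * i))"]) simp
  next
    assume "\<exists>v w. v 0 = n \<and> peval p v w = peval q v w"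
    then obtain v w where vw: "v 0 = n" "peval p v w = peval q v w" by blast
    define m where "m = 2 * (pbound p + pbound q + 1)"
    define b where "b = Max (merge v w ` {..<m})"
    have b: "merge v w i \<le> b" if "i < m" for i
      unfolding b_def using that by (intro Max_ge) auto
    define s where "s x = (case x of 0 \<Rightarrow> 1 | Suc i \<Rightarrow> Suc (min (merge v w i) b))" for x
    define u :: "'a list" where "u = replicate (Suc b) undefined"
    have val: "valuation u s (\<lambda>_. {})"
      by (auto simp: valuation_def positions_def s_def u_def split: nat.split)
    have vals: "pos_value s i = merge v w i" if "i < m" for i
      using b[OF that] by (simp add: pos_value_def s_def)
    have even: "pos_value s (2 * i) = v i" if "i < pbound p + pbound q + 1" for i
      using vals[of "2 * i"] that by (simp add: m_def)
    have odd: "pos_value s (Suc (2 * i)) = w i" if "i < pbound p + pbound q + 1" for i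
      using vals[of "Suc (2 * i)"] that by (simp add: m_def)
    have "peval p (\<lambda>i. pos_value s (2 * i)) (\<lambda>i. pos_value s (Suc (2 * i))) = peval p v w"
      "peval q (\<lambda>i. pos_value s (2 * i)) (\<lambda>i. pos_value s (Suc (2 * i))) = peval q v w"
      by (intro peval_cong; simp add: even odd)+
    moreover have "pos_value s (2 * 0) = n" using even[of 0] vw(1) by simp
    moreover have u: "u \<noteq> []" by (simp add: u_def)
    ultimately have "core_sem (lhs_core r r' p) u s (\<lambda>_. {}) = core_sem (rhs_core r r' q n) u s (\<lambda>_. {})"
      unfolding sem[OF u val] using vw(2) by simp
    with u val show "eq_sat (lhs_core r r' p :: ('a, 'r) core) (rhs_core r r' q n)"
      unfolding eq_sat_def by blast
  qed
qed

lemma core_copies: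
  "core_weights \<Phi> \<subseteq> R \<Longrightarrow> core_weights (copies n \<Phi>) \<subseteq> R"
  "fo_core \<Phi> \<Longrightarrow> fo_core (copies n \<Phi>)"
  unfolding copies_def by (induction n) simp_all

lemma core_pol_core:
  "core_weights \<Phi> \<subseteq> R \<Longrightarrow> core_weights (pol_core p \<Phi>) \<subseteq> R"
  "fo_core \<Phi> \<Longrightarrow> fo_core (pol_core p \<Phi>)"
  by (induction p arbitrary: \<Phi>) (simp_all add: core_copies below_copies_def)

lemma core_const_word: "core_weights (const_word r) = {r}" "fo_core (const_word r)"
  by (simp_all add: const_word_def)

lemma lhs_rhs_core_wFO:
  assumes "r \<in> R" "r' \<in> R"
  shows "lhs_core r r' p \<in> core_wFO R" "rhs_core r r' q n \<in> core_wFO R"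
  using assms by (simp_all add: core_wFO_def core_wMSO_def lhs_core_def rhs_core_def
      core_pol_core core_copies core_const_word del: pol_core.simps)

lemma core_code_copies:
  "core_code lc rc (copies n \<Phi>) =
    ((\<lambda>c. prod_encode (3, prod_encode (c, core_code lc rc \<Phi>))) ^^ n) (prod_encode (0, 0))"
  unfolding copies_def by (induction n) simp_all

lemma undecidable_eq_sat:
  fixes I :: "(('a, 'r) core \<times> ('a, 'r) core) set"
  assumes I: "core_wFO R \<times> core_wFO R \<subseteq> I" and r: "r \<in> R" "r' \<in> R" "r \<noteq> r'"
  shows "\<not> decidable_problem I (pair_code lc rc) (\<lambda>(\<Phi>1, \<Phi>2). eq_sat \<Phi>1 \<Phi>2)"
proof
  assume "decidable_problem I (pair_code lc rc) (\<lambda>(\<Phi>1, \<Phi>2). eq_sat \<Phi>1 \<Phi>2)"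
  then obtain d where d: "\<And>\<Phi>1 \<Phi>2. (\<Phi>1, \<Phi>2) \<in> I \<Longrightarrow>
    reval d [pair_code lc rc (\<Phi>1, \<Phi>2)] (if eq_sat \<Phi>1 \<Phi>2 then 1 else 0)"
    unfolding decidable_problem_def by fastforce
  define h where "h n = core_code lc rc (copies n (const_word r' :: ('a, 'r) core))" for n
  define P where "P v \<longleftrightarrow> (\<exists>a b x y. v 0 = prod_encode (a, b) \<and>
    x = prod_encode (a, prod_encode (3, prod_encode (b, h (v 0)))) \<and>
    y = 0 \<and> reval d [x] y)" for v :: "nat \<Rightarrow> nat"
  have "dioph (\<lambda>v. v 0 = prod_encode (3, prod_encode (v 1, c)))" for c
    by (intro dioph_rules dfun_prod_encode)
  then have h: "dfun (\<lambda>v. h (v i))" for i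
    unfolding h_def core_code_copies by (intro dfun_funpow dfun_var)
  have d': "dioph (\<lambda>v. reval d [v i] (v j))" for i j
    using dioph_reval[of d "[i]" j] by simp
  have "dioph P" unfolding P_def[abs_def]
    by (intro dioph_rules dfun_prod_encode h d')
  then obtain p q where pq: "\<forall>v. P v \<longleftrightarrow> (\<exists>w. peval p v w = peval q v w)" by (rule diophE)
  define F :: "('a, 'r) core" where "F = lhs_core r r' p"
  define a b where "a = core_code lc rc F"
    and "b = core_code lc rc (pol_core q (const_word r) :: ('a, 'r) core)"
  define n where "n = prod_encode (a, b)"
  define G :: "('a, 'r) core" where "G = rhs_core r r' q n"
  have code: "pair_code lc rc (F, G) = prod_encode (a, prod_encode (3, prod_encode (b, h n)))"
    by (simp add: pair_code_def a_def b_def h_def G_def rhs_core_def)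
  have "eq_sat F G \<longleftrightarrow> (\<exists>v. v 0 = n \<and> P v)"
    unfolding F_def G_def eq_sat_pol[OF r(3)] by (simp add: pq)
  also have "\<dots> \<longleftrightarrow> reval d [pair_code lc rc (F, G)] 0"
    unfolding code P_def by (auto simp: n_def intro: exI[of _ "\<lambda>_. prod_encode (a, b)"])
  also have "\<dots> \<longleftrightarrow> \<not> eq_sat F G"
  proof -
    have "(F, G) \<in> I" using I lhs_rhs_core_wFO[OF r(1,2)] unfolding F_def G_def by blast
    from d[OF this] show ?thesis using reval_deterministic[of d] by (auto split: if_splits)
  qed
  finally show False by blast
qed

theorem theorem8:
  fixes R :: "'r set" and lc :: "'a::finite \<Rightarrow> nat" and rc :: "'r \<Rightarrow> nat"
  assumes "inj lc" and "inj_on rc R"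
    and "\<exists>r\<in>R. \<exists>r'\<in>R. r \<noteq> r'"
  shows "\<not> decidable_problem
            (core_wMSO R \<times> core_wMSO R :: (('a, 'r) core \<times> ('a, 'r) core) set)
            (pair_code lc rc) (\<lambda>(\<Phi>1, \<Phi>2). eq_sat \<Phi>1 \<Phi>2) \<and>
         \<not> decidable_problem
            (core_wFO R \<times> core_wFO R :: (('a, 'r) core \<times> ('a, 'r) core) set)
            (pair_code lc rc) (\<lambda>(\<Phi>1, \<Phi>2). eq_sat \<Phi>1 \<Phi>2)"
proof -
  obtain r r' where r: "r \<in> R" "r' \<in> R" "r \<noteq> r'" using assms(3) by blast
  show ?thesis
    by (intro conjI undecidable_eq_sat[OF _ r]) (auto simp: core_wFO_def)
qed

end
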